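(* Let $\mathbb{k}$ be a commutative ring, $n\ge0$, and $\alpha$ a composition of $n$. Then in $\mathbb{k}S_n$, \[ w_0B_\alpha\prod_{\substack{k\in n_\alpha(\Sigma_n)\\ k\neq0}}(w_0B_\alpha+k)(w_0B_\alpha-k)=0, \] the product ranging over the distinct nonzero elements of $n_\alpha(\Sigma_n)$.
   Context: $[n]=\{1,\ldots,n\}$; $S_n$ the symmetric group with $(\sigma\tau)(i)=\sigma(\tau(i))$, $\mathbb{k}S_n$ its group algebra, $w_0(i)=n+1-i$. For a composition $\alpha=(\alpha_1,\ldots,\alpha_k)$ of $n$ let $D(\alpha)=\{\alpha_1,\ldots,\alpha_1+\cdots+\alpha_{k-1}\}$ and $B_\alpha=\sum_{w\in S_n:\operatorname{Des}w\subseteq D(\alpha)}w$, where $\operatorname{Des}w=\{i\in[n-1]:w(i)>w(i+1)\}$. A set composition of $[n]$ is a tuple $F=(F_1,\ldots,F_m)$ of nonempty pairwise disjoint sets with union $[n]$, of type $(|F_1|,\ldots,|F_m|)$; $\Sigma_n$ is the set of all of them. $F\preceq G$ means each block of $F$ lies in some block of $G$. $n_\alpha(F)=\#\{G\in\Sigma_n:F\preceq G,\ \operatorname{type}G=\alpha\}$ and $n_\alpha(\Sigma_n)=\{n_\alpha(F):F\in\Sigma_n\}$. *)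

theory Defs
  imports "HOL-Algebra.Sym_Groups" "HOL-Algebra.Ring"
begin

text \<open>The group algebra of a \<^emph>\<open>finite\<close> group \<open>G\<close> over a commutative ring \<open>R\<close>. The function
  \<open>f\<close> stands for the formal sum of the \<open>f x \<cdot> x\<close> for \<open>x\<close> in \<open>G\<close>, so the product is convolution.
  For infinite \<open>G\<close> this is not the group algebra.\<close>

definition group_algebra ::
  "('r, 'm) ring_scheme \<Rightarrow> ('g, 'l) monoid_scheme \<Rightarrow> ('g \<Rightarrow> 'r) ring"
  where "group_algebra R G =
    \<lparr> carrier = carrier G \<rightarrow>\<^sub>E carrier R,
      mult = (\<lambda>f g. \<lambda>x\<in>carrier G. \<Oplus>\<^bsub>R\<^esub>y\<in>carrier G. f y \<otimes>\<^bsub>R\<^esub> g (inv\<^bsub>G\<^esub> y \<otimes>\<^bsub>G\<^esub> x)),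
      one = (\<lambda>x\<in>carrier G. if x = \<one>\<^bsub>G\<^esub> then \<one>\<^bsub>R\<^esub> else \<zero>\<^bsub>R\<^esub>),
      zero = (\<lambda>x\<in>carrier G. \<zero>\<^bsub>R\<^esub>),
      add = (\<lambda>f g. \<lambda>x\<in>carrier G. f x \<oplus>\<^bsub>R\<^esub> g x) \<rparr>"

definition group_algebra_basis ::
  "('r, 'm) ring_scheme \<Rightarrow> ('g, 'l) monoid_scheme \<Rightarrow> 'g \<Rightarrow> 'g \<Rightarrow> 'r"
  where "group_algebra_basis R G w = (\<lambda>x\<in>carrier G. if x = w then \<one>\<^bsub>R\<^esub> else \<zero>\<^bsub>R\<^esub>)"

text \<open>\<open>finprod\<close> presupposes commutativity, which group algebras lack. Where this is applied to
  polynomials in a single element, the factors commute and the order of the list is immaterial.\<close>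

definition ring_prod_list :: "('a, 'm) ring_scheme \<Rightarrow> 'a list \<Rightarrow> 'a"
  where "ring_prod_list A xs = foldr (\<otimes>\<^bsub>A\<^esub>) xs \<one>\<^bsub>A\<^esub>"

definition longest_perm :: "nat \<Rightarrow> nat \<Rightarrow> nat"
  where "longest_perm n i = (if i \<in> {1..n} then n + 1 - i else i)"

definition Des :: "nat \<Rightarrow> (nat \<Rightarrow> nat) \<Rightarrow> nat set"
  where "Des n w = {i. 1 \<le> i \<and> i < n \<and> w i > w (i + 1)}"

definition is_composition :: "nat \<Rightarrow> nat list \<Rightarrow> bool"
  where "is_composition n \<alpha> \<longleftrightarrow> (\<forall>a\<in>set \<alpha>. a > 0) \<and> sum_list \<alpha> = n"

definition comp_set :: "nat list \<Rightarrow> nat set"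
  where "comp_set \<alpha> = {sum_list (take j \<alpha>) | j. 1 \<le> j \<and> j < length \<alpha>}"

definition B_elem :: "('r, 'm) ring_scheme \<Rightarrow> nat \<Rightarrow> nat list \<Rightarrow> (nat \<Rightarrow> nat) \<Rightarrow> 'r"
  where "B_elem R n \<alpha> =
    (\<Oplus>\<^bsub>group_algebra R (sym_group n)\<^esub>w\<in>{w \<in> carrier (sym_group n). Des n w \<subseteq> comp_set \<alpha>}.
       group_algebra_basis R (sym_group n) w)"

definition set_compositions :: "nat \<Rightarrow> nat set list set"
  where "set_compositions n =
    {F. (\<forall>A\<in>set F. A \<noteq> {}) \<and>
        (\<forall>i<length F. \<forall>j<length F. i \<noteq> j \<longrightarrow> F ! i \<inter> F ! j = {}) \<and>
        \<Union>(set F) = {1..n}}"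

definition block_refines :: "nat set list \<Rightarrow> nat set list \<Rightarrow> bool"
  where "block_refines F G \<longleftrightarrow> (\<forall>A\<in>set F. \<exists>B\<in>set G. A \<subseteq> B)"

definition sc_type :: "nat set list \<Rightarrow> nat list"
  where "sc_type F = map card F"

definition n_comp :: "nat \<Rightarrow> nat list \<Rightarrow> nat set list \<Rightarrow> nat"
  where "n_comp n \<alpha> F = card {G \<in> set_compositions n. block_refines F G \<and> sc_type G = \<alpha>}"

end

theory Submission
  imports Defs
begin

text \<open>All coefficients come from \<open>\<int>\<close>, so it suffices to work with integer-valued functions on \<open>S\<^sub>n\<close>.
  Identify a permutation \<open>w\<close> with the chamber \<open>({w 1}, \<dots>, {w n})\<close>. Then \<open>v \<mapsto> v w\<^sub>0 B\<^sub>\<alpha>\<close> is left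
  multiplication by \<open>y = \<Sum>G s\<close>, where \<open>G\<close> runs over the set compositions of type \<open>\<alpha>\<close>, multiplied in
  the face monoid, and \<open>s\<close> is reversal, an automorphism of that monoid. For a face \<open>F\<close> one has
  \<open>F G = F\<close> iff \<open>F \<preceq> G\<close>, and otherwise \<open>n\<^sub>\<alpha>(F G) > n\<^sub>\<alpha>(F)\<close>; the same holds for the reversal of \<open>G\<close>.
  So, up to faces \<open>F'\<close> with \<open>n\<^sub>\<alpha>(F') > k = n\<^sub>\<alpha>(F)\<close>, right multiplication by \<open>y\<close> sends \<open>F\<close> to \<open>k F s\<close>
  and \<open>F s\<close> to \<open>k F\<close>. Hence each factor \<open>y\<^sup>2 - k\<^sup>2\<close> (and \<open>y\<close> itself for \<open>k = 0\<close>) pushes the span of the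
  \<open>F\<close> and \<open>F s\<close> with \<open>n\<^sub>\<alpha>(F) \<ge> k\<close> into the span of those with \<open>n\<^sub>\<alpha>(F) > k\<close>. After all factors
  the one-block face, which is the unit, is sent to \<open>0\<close>.\<close>

section \<open>Integral elements of group algebras\<close>

definition convolution :: "('g, 'l) monoid_scheme \<Rightarrow> ('g \<Rightarrow> int) \<Rightarrow> ('g \<Rightarrow> int) \<Rightarrow> 'g \<Rightarrow> int"
  where "convolution G f g x = (\<Sum>y\<in>carrier G. f y * g (inv\<^bsub>G\<^esub> y \<otimes>\<^bsub>G\<^esub> x))"

text \<open>Coefficientwise image under the canonical map from the integers to \<open>R\<close>; the
  restriction yields the extensional functions that form the carrier of
  \<open>group_algebra R G\<close>.\<close>

definition base_change ::
  "('r, 'm) ring_scheme \<Rightarrow> ('g, 'l) monoid_scheme \<Rightarrow> ('g \<Rightarrow> int) \<Rightarrow> 'g \<Rightarrow> 'r"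
  where "base_change R G f = (\<lambda>x\<in>carrier G. [f x] \<cdot>\<^bsub>R\<^esub> \<one>\<^bsub>R\<^esub>)"

text \<open>Integer functions are not cut off outside the carrier, so identities are stated
  pointwise on it; this lemma carries them through a further convolution.\<close>

lemma convolution_cong:
  assumes "group G" "x \<in> carrier G"
    and "\<And>y. y \<in> carrier G \<Longrightarrow> f y = f' y" "\<And>y. y \<in> carrier G \<Longrightarrow> g y = g' y"
  shows "convolution G f g x = convolution G f' g' x"
proof -
  interpret group G by fact
  show ?thesis
    unfolding convolution_def using assms by (intro sum.cong) auto
qed

lemma convolution_assoc:
  fixes G (structure)
  assumes "group G" "x \<in> carrier G"
  shows "convolution G (convolution G f g) h x = convolution G f (convolution G g h) x"
proof -
  interpret group G by fact
  \<comment> \<open>Left translation by \<open>z\<close> reindexes the inner sum.\<close>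
  have shift: "(\<Sum>y\<in>carrier G. g (inv z \<otimes> y) * h (inv y \<otimes> x)) =
      (\<Sum>y\<in>carrier G. g y * h (inv y \<otimes> (inv z \<otimes> x)))" if z: "z \<in> carrier G" for z
  proof (rule sum.reindex_bij_witness[where i = "\<lambda>y. z \<otimes> y" and j = "\<lambda>y. inv z \<otimes> y"])
    fix y assume y: "y \<in> carrier G"
    have "inv (inv z \<otimes> y) \<otimes> (inv z \<otimes> x) = inv y \<otimes> (z \<otimes> (inv z \<otimes> x))"
      using y z assms(2) by (simp add: inv_mult_group m_assoc)
    also have "\<dots> = inv y \<otimes> x"
      using z assms(2) by (simp add: m_assoc[symmetric])
    finally show "g (inv z \<otimes> y) * h (inv (inv z \<otimes> y) \<otimes> (inv z \<otimes> x)) =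
        g (inv z \<otimes> y) * h (inv y \<otimes> x)" by simp
  qed (use z in \<open>auto simp: m_assoc[symmetric]\<close>)
  have "convolution G (convolution G f g) h x =
      (\<Sum>y\<in>carrier G. \<Sum>z\<in>carrier G. f z * (g (inv z \<otimes> y) * h (inv y \<otimes> x)))"
    unfolding convolution_def by (simp add: sum_distrib_right mult.assoc)
  also have "\<dots> = (\<Sum>z\<in>carrier G. \<Sum>y\<in>carrier G. f z * (g (inv z \<otimes> y) * h (inv y \<otimes> x)))"
    by (rule sum.swap)
  also have "\<dots> = convolution G f (convolution G g h) x"
    unfolding convolution_def using shift by (simp add: sum_distrib_left[symmetric])
  finally show ?thesis .
qed

lemma convolution_indicator_left:
  assumes "group G" "finite (carrier G)" "w \<in> carrier G"
  shows "convolution G (\<lambda>y. of_bool (y = w)) f x = f (inv\<^bsub>G\<^esub> w \<otimes>\<^bsub>G\<^esub> x)"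
proof -
  have "convolution G (\<lambda>y. of_bool (y = w)) f x =
      (\<Sum>y\<in>carrier G. if y = w then f (inv\<^bsub>G\<^esub> y \<otimes>\<^bsub>G\<^esub> x) else 0)"
    unfolding convolution_def by (intro sum.cong) auto
  then show ?thesis
    using assms by (simp add: sum.delta)
qed

lemma convolution_one_left:
  assumes "group G" "finite (carrier G)" "x \<in> carrier G"
  shows "convolution G (\<lambda>y. of_bool (y = \<one>\<^bsub>G\<^esub>)) f x = f x"
proof -
  interpret group G by fact
  show ?thesis
    using assms by (simp add: convolution_indicator_left)
qed

lemma convolution_one_right:
  fixes G (structure)
  assumes "group G" "finite (carrier G)" "x \<in> carrier G"
  shows "convolution G f (\<lambda>y. of_bool (y = \<one>\<^bsub>G\<^esub>)) x = f x"
proof -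
  interpret group G by fact
  have "convolution G f (\<lambda>y. of_bool (y = \<one>\<^bsub>G\<^esub>)) x =
      (\<Sum>y\<in>carrier G. if y = x then f y else 0)"
    unfolding convolution_def
  proof (intro sum.cong refl)
    fix y assume "y \<in> carrier G"
    moreover from this have "inv y \<otimes> x = \<one> \<longleftrightarrow> y = x"
      using assms(3) inv_equality inv_inv l_inv by (metis inv_closed)
    ultimately show "f y * of_bool (inv y \<otimes> x = \<one>) = (if y = x then f y else 0)" by simp
  qed
  then show ?thesis
    using assms by (simp add: sum.delta)
qed

lemma convolution_diff_left:
  "convolution G (\<lambda>y. f y - c * g y) h x = convolution G f h x - c * convolution G g h x"
  unfolding convolution_def by (simp add: algebra_simps sum_subtractf sum_distrib_left)

lemma convolution_add_left:
  "convolution G (\<lambda>y. f y + c * g y) h x = convolution G f h x + c * convolution G g h x"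
  unfolding convolution_def by (simp add: algebra_simps sum.distrib sum_distrib_left)

lemma convolution_diff_right:
  "convolution G f (\<lambda>y. g y - c * h y) x = convolution G f g x - c * convolution G f h x"
  unfolding convolution_def by (simp add: algebra_simps sum_subtractf sum_distrib_left)

section \<open>Base change from integer coefficients to \<open>R\<close>\<close>

lemma add_pow_int_zero: "[(0 :: int)] \<cdot>\<^bsub>R\<^esub> a = \<zero>\<^bsub>R\<^esub>"
  by (simp add: add_pow_def)

lemma (in ring) int_one_mult: "[i] \<cdot>\<^bsub>R\<^esub> \<one> \<otimes> [j] \<cdot>\<^bsub>R\<^esub> \<one> = [(i * j :: int)] \<cdot>\<^bsub>R\<^esub> \<one>"
  by (simp add: add_pow_ldistr_int add.int_pow_pow mult.commute)

lemma (in ring) finsum_int_one: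
  assumes "finite I"
  shows "(\<Oplus>i\<in>I. [(f i :: int)] \<cdot>\<^bsub>R\<^esub> \<one>) = [sum f I] \<cdot>\<^bsub>R\<^esub> \<one>"
  using assms by (induction I rule: finite_induct) (auto simp: add.int_pow_mult add_pow_int_zero)

text \<open>Integer multiples of the unit of \<open>R\<close> add and multiply as integers do, so
  each coefficient of the product can be computed over the integers.\<close>

lemma base_change_mult:
  assumes "ring R" "group G" "finite (carrier G)"
  shows "base_change R G f \<otimes>\<^bsub>group_algebra R G\<^esub> base_change R G g =
    base_change R G (convolution G f g)"
proof -
  interpret R: ring R by fact
  interpret G: group G by fact
  show ?thesis
  proof
    fix x
    show "(base_change R G f \<otimes>\<^bsub>group_algebra R G\<^esub> base_change R G g) x =
        base_change R G (convolution G f g) x"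
    proof (cases "x \<in> carrier G")
      case True
      then have "(base_change R G f \<otimes>\<^bsub>group_algebra R G\<^esub> base_change R G g) x =
          (\<Oplus>\<^bsub>R\<^esub>y\<in>carrier G. [(f y * g (inv\<^bsub>G\<^esub> y \<otimes>\<^bsub>G\<^esub> x))] \<cdot>\<^bsub>R\<^esub> \<one>\<^bsub>R\<^esub>)"
        by (auto simp: group_algebra_def base_change_def R.int_one_mult intro!: R.finsum_cong')
      also have "\<dots> = [(\<Sum>y\<in>carrier G. f y * g (inv\<^bsub>G\<^esub> y \<otimes>\<^bsub>G\<^esub> x))] \<cdot>\<^bsub>R\<^esub> \<one>\<^bsub>R\<^esub>"
        using assms(3) by (rule R.finsum_int_one)
      finally show ?thesis
        using True by (simp add: base_change_def convolution_def)
    qed (simp add: group_algebra_def base_change_def)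
  qed
qed

lemma base_change_add:
  assumes "ring R"
  shows "base_change R G f \<oplus>\<^bsub>group_algebra R G\<^esub> base_change R G g =
    base_change R G (\<lambda>x. f x + g x)"
proof -
  interpret R: ring R by fact
  show ?thesis
    by (auto simp: group_algebra_def base_change_def R.add.int_pow_mult)
qed

lemma base_change_zero: "base_change R G (\<lambda>x. 0) = \<zero>\<^bsub>group_algebra R G\<^esub>"
  by (simp add: group_algebra_def base_change_def add_pow_int_zero)

lemma base_change_basis:
  assumes "ring R"
  shows "base_change R G (\<lambda>x. of_bool (x = w)) = group_algebra_basis R G w"
proof -
  interpret R: ring R by fact
  show ?thesis
    by (auto simp: group_algebra_basis_def base_change_def add_pow_int_zero intro!: restrict_ext)
qed

lemma base_change_one:
  assumes "ring R"
  shows "base_change R G (\<lambda>x. of_bool (x = \<one>\<^bsub>G\<^esub>)) = \<one>\<^bsub>group_algebra R G\<^esub>"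
  using base_change_basis[OF assms, of G "\<one>\<^bsub>G\<^esub>"]
  by (simp add: group_algebra_basis_def group_algebra_def)

lemma base_change_closed:
  assumes "ring R"
  shows "base_change R G f \<in> carrier (group_algebra R G)"
proof -
  interpret R: ring R by fact
  show ?thesis
    by (auto simp: group_algebra_def base_change_def)
qed

lemma base_change_cong:
  "(\<And>x. x \<in> carrier G \<Longrightarrow> f x = g x) \<Longrightarrow> base_change R G f = base_change R G g"
  by (auto simp: base_change_def)

text \<open>Supplies the additive structure behind finite sums, differences and multiples of the
  unit in the group algebra; products are evaluated through \<open>base_change_mult\<close>.\<close>

lemma abelian_group_group_algebra:
  assumes "ring R"
  shows "abelian_group (group_algebra R G)"
proof -
  interpret R: ring R by fact
  show ?thesis
  proof (rule abelian_groupI)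
    fix f assume f: "f \<in> carrier (group_algebra R G)"
    show "\<exists>g\<in>carrier (group_algebra R G). g \<oplus>\<^bsub>group_algebra R G\<^esub> f = \<zero>\<^bsub>group_algebra R G\<^esub>"
      using f by (intro bexI[of _ "\<lambda>x\<in>carrier G. \<ominus>\<^bsub>R\<^esub> f x"])
        (auto simp: group_algebra_def intro!: restrict_ext R.l_neg)
    show "\<zero>\<^bsub>group_algebra R G\<^esub> \<oplus>\<^bsub>group_algebra R G\<^esub> f = f"
    proof
      fix x
      show "(\<zero>\<^bsub>group_algebra R G\<^esub> \<oplus>\<^bsub>group_algebra R G\<^esub> f) x = f x"
        using f by (cases "x \<in> carrier G") (auto simp: group_algebra_def PiE_def extensional_def intro!: R.l_zero)
    qed
  qed (auto simp: group_algebra_def intro!: restrict_ext R.a_assoc R.a_comm)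
qed

lemma base_change_nat_one:
  assumes "ring R"
  shows "[(k :: nat)] \<cdot>\<^bsub>group_algebra R G\<^esub> \<one>\<^bsub>group_algebra R G\<^esub> =
    base_change R G (\<lambda>x. int k * of_bool (x = \<one>\<^bsub>G\<^esub>))"
proof -
  interpret A: abelian_group "group_algebra R G"
    using assms by (rule abelian_group_group_algebra)
  show ?thesis
  proof (induction k)
    case 0
    then show ?case using base_change_zero[of R G] by simp
  next
    case (Suc k)
    then show ?case
      by (simp add: base_change_one[OF assms, symmetric] base_change_add[OF assms] algebra_simps)
  qed
qed

lemma base_change_minus:
  assumes "ring R"
  shows "base_change R G f \<ominus>\<^bsub>group_algebra R G\<^esub> base_change R G g =
    base_change R G (\<lambda>x. f x - g x)"
proof -
  interpret A: abelian_group "group_algebra R G"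
    using assms by (rule abelian_group_group_algebra)
  have "\<ominus>\<^bsub>group_algebra R G\<^esub> base_change R G g = base_change R G (\<lambda>x. - g x)"
    by (rule A.minus_equality) (auto simp: base_change_add base_change_closed base_change_zero assms)
  then show ?thesis
    by (simp add: a_minus_def base_change_add assms)
qed

lemma base_change_indicator:
  assumes "ring R" "finite W"
  shows "(\<Oplus>\<^bsub>group_algebra R G\<^esub>w\<in>W. group_algebra_basis R G w) =
    base_change R G (\<lambda>x. of_bool (x \<in> W))"
proof -
  interpret A: abelian_group "group_algebra R G"
    using assms(1) by (rule abelian_group_group_algebra)
  have basis: "group_algebra_basis R G w \<in> carrier (group_algebra R G)" for w
    using base_change_closed[OF assms(1)] base_change_basis[OF assms(1)] by metis
  show ?thesis
    using assms(2)
  proof (induction W rule: finite_induct)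
    case empty
    then show ?case using base_change_zero[of R G] by simp
  next
    case (insert w W)
    then have "(\<Oplus>\<^bsub>group_algebra R G\<^esub>v\<in>insert w W. group_algebra_basis R G v) =
        base_change R G (\<lambda>x. of_bool (x = w) + of_bool (x \<in> W))"
      by (simp add: basis base_change_add[OF assms(1), symmetric] base_change_basis[OF assms(1)])
    then show ?case
      using insert(2) by (auto intro: base_change_cong)
  qed
qed

section \<open>Faces as weak orders\<close>

text \<open>The blocks are the level sets of \<open>f\<close>, listed by increasing value. Gaps
  between the values are allowed, so that faces can be combined by arithmetic on
  \<open>f\<close>.\<close>

definition weak_order :: "nat \<Rightarrow> (nat \<Rightarrow> nat) \<Rightarrow> (nat \<times> nat) set"
  where "weak_order n f = {(a, b). a \<in> {1..n} \<and> b \<in> {1..n} \<and> f a < f b}"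

text \<open>A set composition is encoded by the strict weak order "the block of \<open>a\<close> precedes the block
  of \<open>b\<close>". In this encoding \<open>tits_prod\<close> is the product of faces of the braid arrangement (the
  nonempty intersections \<open>F\<^sub>i \<inter> G\<^sub>j\<close>, ordered lexicographically), and reversing a set composition
  is taking the converse.\<close>

definition tits_prod :: "('a \<times> 'a) set \<Rightarrow> ('a \<times> 'a) set \<Rightarrow> ('a \<times> 'a) set"
  where "tits_prod P Q = P \<union> (Q - P\<inverse>)"

definition sc_order :: "nat set list \<Rightarrow> (nat \<times> nat) set"
  where "sc_order F = {(a, b). \<exists>i j. i < j \<and> j < length F \<and> a \<in> F ! i \<and> b \<in> F ! j}"

lemma tits_prod_assoc: "tits_prod (tits_prod P Q) S = tits_prod P (tits_prod Q S)"
  unfolding tits_prod_def by auto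

lemma converse_tits_prod: "(tits_prod P Q)\<inverse> = tits_prod (P\<inverse>) (Q\<inverse>)"
  unfolding tits_prod_def by auto

text \<open>\<open>P\<close> already decides every pair that \<open>Q\<close> decides, so nothing is
  added. For faces this is F G = F when F \<preceq> G.\<close>

lemma tits_prod_absorb: "Q \<subseteq> P \<union> P\<inverse> \<Longrightarrow> tits_prod P Q = P"
  unfolding tits_prod_def by auto

text \<open>The lexicographic order is coded by two-digit numbers in base \<open>N\<close>; the
  bound on \<open>g\<close> prevents a carry into the digit of \<open>f\<close>.\<close>

lemma tits_prod_weak_order:
  assumes "\<And>a. a \<in> {1..n} \<Longrightarrow> g a < N"
  shows "tits_prod (weak_order n f) (weak_order n g) = weak_order n (\<lambda>a. f a * N + g a)"
proof -
  have lex: "f a * N + g a < f b * N + g b \<longleftrightarrow> f a < f b \<or> f a = f b \<and> g a < g b"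
    if "a \<in> {1..n}" "b \<in> {1..n}" for a b
  proof -
    have *: "f c * N + g c < f d * N + g d" if "f c < f d" "c \<in> {1..n}" for c d
    proof -
      have "f c * N + g c < Suc (f c) * N" using assms[OF that(2)] by simp
      also have "\<dots> \<le> f d * N" using that(1) by (intro mult_le_mono1) simp
      finally show ?thesis by simp
    qed
    show ?thesis
      using *[of a b] *[of b a] that by (cases "f a" "f b" rule: linorder_cases) auto
  qed
  show ?thesis
    unfolding tits_prod_def weak_order_def using lex by (auto simp: converse_iff)
qed

lemma bounded_on_interval: "\<exists>N. \<forall>a\<in>{1..n}. g a < (N :: nat)" for g :: "nat \<Rightarrow> nat"
  using finite_nat_set_iff_bounded[of "g ` {1..n}"] by auto

lemma tits_prod_weak_order_ex:
  "\<exists>h. tits_prod (weak_order n f) (weak_order n g) = weak_order n h"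
  using tits_prod_weak_order bounded_on_interval by metis

lemma converse_weak_order_ex: "\<exists>g. (weak_order n f)\<inverse> = weak_order n g"
proof -
  obtain N where N: "\<forall>a\<in>{1..n}. f a < N"
    using bounded_on_interval by blast
  \<comment> \<open>Subtraction from a strict upper bound reverses the order without
    truncating.\<close>
  have "(weak_order n f)\<inverse> = weak_order n (\<lambda>a. N - f a)"
  proof (intro Set.set_eqI)
    fix p :: "nat \<times> nat"
    obtain a b where p: "p = (a, b)" by force
    show "p \<in> (weak_order n f)\<inverse> \<longleftrightarrow> p \<in> weak_order n (\<lambda>a. N - f a)"
    proof (cases "a \<in> {1..n} \<and> b \<in> {1..n}")
      case True
      then have "f a < N" "f b < N" using N by auto
      then show ?thesis using p True by (auto simp: weak_order_def)
    qed (auto simp: weak_order_def p)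
  qed
  then show ?thesis by blast
qed

section \<open>Dictionary between set compositions and weak orders\<close>

lemma set_composition_block:
  assumes "G \<in> set_compositions n" "a \<in> {1..n}"
  shows "\<exists>!i. i < length G \<and> a \<in> G ! i"
proof -
  have "a \<in> \<Union> (set G)" using assms by (simp add: set_compositions_def)
  then obtain i where "i < length G" "a \<in> G ! i" by (metis UnionE in_set_conv_nth)
  moreover have "j = i" if "j < length G" "a \<in> G ! j" for j
  proof (rule ccontr)
    assume "j \<noteq> i"
    then have "G ! j \<inter> G ! i = {}"
      using assms(1) that(1) \<open>i < length G\<close> by (simp add: set_compositions_def)
    then show False using that \<open>a \<in> G ! i\<close> by blast
  qed
  ultimately show ?thesis by blast
qed

lemma set_composition_block_subset:
  assumes "G \<in> set_compositions n" "i < length G"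
  shows "G ! i \<subseteq> {1..n}"
  using assms nth_mem by (auto simp: set_compositions_def)

lemma sc_order_is_weak_order:
  assumes "G \<in> set_compositions n"
  shows "\<exists>g. sc_order G = weak_order n g"
proof -
  \<comment> \<open>The index of the block containing \<open>a\<close>, unique because the blocks
    partition the interval.\<close>
  define g where "g a = (THE i. i < length G \<and> a \<in> G ! i)" for a
  have g: "g a < length G \<and> a \<in> G ! g a" if "a \<in> {1..n}" for a
    unfolding g_def using set_composition_block[OF assms that] by (rule theI')
  have g_eq: "g a = i" if "i < length G" "a \<in> G ! i" for a i
  proof -
    have "a \<in> {1..n}" using set_composition_block_subset[OF assms that(1)] that(2) by blast
    then show ?thesis using g set_composition_block[OF assms] that by blast
  qed
  have "sc_order G = weak_order n g"
  proof (intro Set.set_eqI iffI)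
    fix p assume "p \<in> sc_order G"
    then obtain a b i j where p: "p = (a, b)" "i < j" "j < length G" "a \<in> G ! i" "b \<in> G ! j"
      by (auto simp: sc_order_def)
    have "i < length G" using p by simp
    then have "a \<in> {1..n}" "b \<in> {1..n}"
      using set_composition_block_subset[OF assms] p by blast+
    then show "p \<in> weak_order n g"
      using p g_eq[of i a] g_eq[of j b] by (simp add: weak_order_def)
  next
    fix p assume "p \<in> weak_order n g"
    then obtain a b where p: "p = (a, b)" "a \<in> {1..n}" "b \<in> {1..n}" "g a < g b"
      by (auto simp: weak_order_def)
    then show "p \<in> sc_order G"
      using g[OF p(2)] g[OF p(3)] unfolding sc_order_def by blast
  qed
  then show ?thesis by blast
qed

lemma weak_order_is_sc_order:
  "\<exists>F\<in>set_compositions n. sc_order F = weak_order n f"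
proof -
  \<comment> \<open>Only attained values are listed, so every level set is a nonempty block.\<close>
  define L where "L = sorted_list_of_set (f ` {1..n})"
  define F where "F = map (\<lambda>i. {a \<in> {1..n}. f a = i}) L"
  have set_L: "set L = f ` {1..n}" and L: "sorted_wrt (<) L"
    by (simp_all add: L_def)
  have F_nth: "F ! i = {a \<in> {1..n}. f a = L ! i}" if "i < length L" for i
    using that by (simp add: F_def)
  have L_less: "L ! i < L ! j \<longleftrightarrow> i < j" if "i < length L" "j < length L" for i j
    using L that sorted_wrt_nth_less[of "(<)" L] by (metis linorder_neqE_nat order_less_asym)
  have "F \<in> set_compositions n"
    unfolding set_compositions_def
  proof (intro CollectI conjI ballI allI impI)
    fix A assume "A \<in> set F"
    then show "A \<noteq> {}" using set_L by (auto simp: F_def)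
  next
    fix i j assume "i < length F" "j < length F" "i \<noteq> j"
    then have "L ! i \<noteq> L ! j" "i < length L" "j < length L"
      using L_less[of i j] L_less[of j i] by (auto simp: F_def neq_iff)
    then show "F ! i \<inter> F ! j = {}" by (auto simp: F_nth)
  next
    show "\<Union> (set F) = {1..n}" using set_L by (auto simp: F_def)
  qed
  moreover have "sc_order F = weak_order n f"
  proof (intro Set.set_eqI iffI)
    fix p assume "p \<in> sc_order F"
    then obtain a b i j where p: "p = (a, b)" "i < j" "j < length L" "a \<in> F ! i" "b \<in> F ! j"
      by (auto simp: sc_order_def F_def)
    then show "p \<in> weak_order n f"
      using L_less[of i j] by (auto simp: weak_order_def F_nth)
  next
    fix p assume "p \<in> weak_order n f"
    then obtain a b where p: "p = (a, b)" "a \<in> {1..n}" "b \<in> {1..n}" "f a < f b"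
      by (auto simp: weak_order_def)
    then have "f a \<in> set L" "f b \<in> set L" by (auto simp: set_L)
    then obtain i j where ij: "i < length L" "L ! i = f a" "j < length L" "L ! j = f b"
      by (auto simp: in_set_conv_nth)
    then have "i < j" using L_less p by metis
    then show "p \<in> sc_order F"
      using p ij unfolding sc_order_def
      by (intro CollectI case_prodI2 exI[of _ i] exI[of _ j]) (auto simp: F_nth, auto simp: F_def)
  qed
  ultimately show ?thesis by blast
qed

text \<open>The symmetric closure of \<open>sc_order F\<close> consists of the pairs lying in
  different blocks of \<open>F\<close>. Refinement says that elements sharing a block of
  \<open>F\<close> share one of \<open>G\<close>; the inclusion is the contrapositive.\<close>

lemma block_refines_iff_sc_order:
  assumes F: "F \<in> set_compositions n" and G: "G \<in> set_compositions n"
  shows "block_refines F G \<longleftrightarrow> sc_order G \<subseteq> sc_order F \<union> (sc_order F)\<inverse>"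
proof
  assume ref: "block_refines F G"
  show "sc_order G \<subseteq> sc_order F \<union> (sc_order F)\<inverse>"
  proof (intro subrelI, rule ccontr)
    fix a b assume ab: "(a, b) \<in> sc_order G" and no: "(a, b) \<notin> sc_order F \<union> (sc_order F)\<inverse>"
    obtain i j where ij: "i < j" "j < length G" "a \<in> G ! i" "b \<in> G ! j"
      using ab by (auto simp: sc_order_def)
    have i: "i < length G" using ij by simp
    have abn: "a \<in> {1..n}" "b \<in> {1..n}"
      using ij i set_composition_block_subset[OF G] by blast+
    obtain k l where kl: "k < length F" "a \<in> F ! k" "l < length F" "b \<in> F ! l"
      using set_composition_block[OF F] abn by meson
    have "k = l"
    proof (cases k l rule: linorder_cases)
      case less
      then have "(a, b) \<in> sc_order F" using kl unfolding sc_order_def by blast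
      then show ?thesis using no by blast
    next
      case greater
      then have "(b, a) \<in> sc_order F" using kl unfolding sc_order_def by blast
      then show ?thesis using no by blast
    qed
    moreover obtain B where "B \<in> set G" "F ! k \<subseteq> B"
      using ref kl nth_mem unfolding block_refines_def by blast
    ultimately obtain m where "m < length G" "a \<in> G ! m" "b \<in> G ! m"
      using kl by (metis in_set_conv_nth subsetD)
    then have "m = i" "m = j"
      using set_composition_block[OF G] abn ij i by blast+
    then show False using ij by simp
  qed
next
  assume sub: "sc_order G \<subseteq> sc_order F \<union> (sc_order F)\<inverse>"
  show "block_refines F G"
    unfolding block_refines_def
  proof
    fix A assume "A \<in> set F"
    then obtain k where k: "k < length F" "A = F ! k" by (metis in_set_conv_nth)
    have "A \<noteq> {}" using F \<open>A \<in> set F\<close> by (auto simp: set_compositions_def)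
    then obtain a where a: "a \<in> A" by blast
    have An: "A \<subseteq> {1..n}" using set_composition_block_subset[OF F] k by blast
    obtain i where i: "i < length G" "a \<in> G ! i"
      using set_composition_block[OF G] a An by blast
    have "A \<subseteq> G ! i"
    proof
      fix b assume b: "b \<in> A"
      obtain j where j: "j < length G" "b \<in> G ! j"
        using set_composition_block[OF G] b An by blast
      have same: "p = k" if "p < length F" "c \<in> F ! p" "c \<in> A" for p c
        using set_composition_block[OF F, of c] that k An by blast
      have no: "(c, d) \<notin> sc_order F" if cd: "c \<in> A" "d \<in> A" for c d
      proof
        assume "(c, d) \<in> sc_order F"
        then obtain p q where "p < q" "q < length F" "c \<in> F ! p" "d \<in> F ! q"
          by (auto simp: sc_order_def)
        then show False using same[of p c] same[of q d] cd by simp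
      qed
      have "(a, b) \<notin> sc_order G" "(b, a) \<notin> sc_order G"
        using no[OF a b] no[OF b a] sub by blast+
      then have "\<not> i < j" "\<not> j < i"
        using i j unfolding sc_order_def by blast+
      then show "b \<in> G ! i" using j by (metis linorder_neqE_nat)
    qed
    then show "\<exists>B\<in>set G. A \<subseteq> B" using i by (meson nth_mem)
  qed
qed

text \<open>The number \<open>n\<^sub>\<alpha>(F)\<close> expressed through the order \<open>P\<close> of \<open>F\<close>.\<close>

definition refine_count :: "nat \<Rightarrow> nat list \<Rightarrow> (nat \<times> nat) set \<Rightarrow> nat"
  where "refine_count n \<alpha> P =
    card {G \<in> set_compositions n. sc_type G = \<alpha> \<and> sc_order G \<subseteq> P \<union> P\<inverse>}"

text \<open>Every weak order comes from a set composition, so its count is among the values indexing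
  the product in the theorem.\<close>

lemma refine_count_weak_order:
  "refine_count n \<alpha> (weak_order n f) \<in> n_comp n \<alpha> ` set_compositions n"
proof -
  obtain F where F: "F \<in> set_compositions n" "sc_order F = weak_order n f"
    using weak_order_is_sc_order by blast
  have "refine_count n \<alpha> (weak_order n f) = n_comp n \<alpha> F"
    unfolding refine_count_def n_comp_def F(2)[symmetric]
    using block_refines_iff_sc_order[OF F(1)] by (intro arg_cong[of _ _ card]) auto
  then show ?thesis using F(1) by blast
qed

lemma finite_set_compositions_of_type:
  "finite {G \<in> set_compositions n. sc_type G = \<alpha>}"
proof (rule finite_subset)
  show "{G \<in> set_compositions n. sc_type G = \<alpha>} \<subseteq>
      {G. set G \<subseteq> Pow {1..n} \<and> length G = length \<alpha>}"
    by (auto simp: set_compositions_def sc_type_def)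
  show "finite {G. set G \<subseteq> Pow {1..n} \<and> length G = length \<alpha>}"
    by (rule finite_lists_length_eq) simp
qed

text \<open>The product contains \<open>P\<close> and separates all pairs that \<open>G\<close>
  separates, so every face counted before is still counted and \<open>G\<close> is gained. Symmetric
  closures make the reversal of \<open>G\<close> serve equally well.\<close>

lemma refine_count_tits_prod_less:
  assumes "G \<in> set_compositions n" "sc_type G = \<alpha>" "\<not> sc_order G \<subseteq> P \<union> P\<inverse>"
    and "Q = sc_order G \<or> Q = (sc_order G)\<inverse>"
  shows "refine_count n \<alpha> P < refine_count n \<alpha> (tits_prod P Q)"
  unfolding refine_count_def
proof (rule psubset_card_mono)
  show "finite {H \<in> set_compositions n. sc_type H = \<alpha> \<and> sc_order H \<subseteq> tits_prod P Q \<union> (tits_prod P Q)\<inverse>}"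
    by (rule finite_subset[OF _ finite_set_compositions_of_type[of n \<alpha>]]) auto
  have "sc_order G \<subseteq> tits_prod P Q \<union> (tits_prod P Q)\<inverse>" "P \<subseteq> tits_prod P Q"
    using assms(4) by (auto simp: tits_prod_def)
  then show "{H \<in> set_compositions n. sc_type H = \<alpha> \<and> sc_order H \<subseteq> P \<union> P\<inverse>} \<subset>
      {H \<in> set_compositions n. sc_type H = \<alpha> \<and> sc_order H \<subseteq> tits_prod P Q \<union> (tits_prod P Q)\<inverse>}"
    using assms(1-3) by blast
qed

section \<open>Permutations as chambers\<close>

text \<open>\<open>inv' w a\<close> is the position of \<open>a\<close> in the word w(1), ..., w(n),
  so \<open>a\<close> precedes \<open>b\<close> when it stands further left.\<close>

definition chamber :: "nat \<Rightarrow> (nat \<Rightarrow> nat) \<Rightarrow> (nat \<times> nat) set"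
  where "chamber n w = weak_order n (inv' w)"

lemma chamber_image_iff:
  assumes "w permutes {1..n}"
  shows "(w i, w j) \<in> chamber n w \<longleftrightarrow> i \<in> {1..n} \<and> j \<in> {1..n} \<and> i < j"
  using permutes_in_image[OF assms] permutes_inverses(2)[OF assms]
  by (auto simp: chamber_def weak_order_def simp del: atLeastAtMost_iff)

text \<open>Replacing the values of an injective \<open>h\<close> by their ranks keeps the order and
  gives a permutation, whose inverse lists the interval in that order.\<close>

lemma rank_permutation:
  assumes "inj_on h {1..n}"
  shows "\<exists>u. u permutes {1..n} \<and> weak_order n (h :: nat \<Rightarrow> nat) = chamber n u"
proof -
  \<comment> \<open>Counting \<open>a\<close> itself makes ranks start at 1; the identity outside
    the interval is what \<open>permutes\<close> demands.\<close>
  define r where "r a = (if a \<in> {1..n} then card {b \<in> {1..n}. h b \<le> h a} else a)" for a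
  have less: "r a < r b" if "a \<in> {1..n}" "b \<in> {1..n}" "h a < h b" for a b
  proof -
    have "card {c \<in> {1..n}. h c \<le> h a} < card {c \<in> {1..n}. h c \<le> h b}"
    proof (rule psubset_card_mono)
      have "b \<in> {c \<in> {1..n}. h c \<le> h b} - {c \<in> {1..n}. h c \<le> h a}" using that by simp
      then show "{c \<in> {1..n}. h c \<le> h a} \<subset> {c \<in> {1..n}. h c \<le> h b}"
        using that(3) by fastforce
    qed simp
    then show ?thesis using that by (simp add: r_def)
  qed
  have less_iff: "r a < r b \<longleftrightarrow> h a < h b" if "a \<in> {1..n}" "b \<in> {1..n}" for a b
    using less[of a b] less[of b a] that assms
    by (cases "h a" "h b" rule: linorder_cases) (auto dest: inj_onD)
  have inj: "inj_on r {1..n}"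
  proof (rule inj_onI)
    fix a b assume ab: "a \<in> {1..n}" "b \<in> {1..n}" "r a = r b"
    then have "h a = h b" using less_iff[OF ab(1,2)] less_iff[OF ab(2,1)] by simp
    then show "a = b" using assms ab by (simp add: inj_on_eq_iff)
  qed
  have r_in: "r a \<in> {1..n}" if "a \<in> {1..n}" for a
  proof -
    have "card {b \<in> {1..n}. h b \<le> h a} \<le> card {1..n}" by (rule card_mono) auto
    moreover have "a \<in> {b \<in> {1..n}. h b \<le> h a}" using that by simp
    then have "card {b \<in> {1..n}. h b \<le> h a} > 0" by (subst card_gt_0_iff) auto
    ultimately show ?thesis using that by (simp add: r_def)
  qed
  have "r ` {1..n} = {1..n}"
    using inj r_in by (intro endo_inj_surj) auto
  then have "r permutes {1..n}"
    using inj by (intro bij_imp_permutes) (auto simp: bij_betw_def r_def)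
  moreover have "weak_order n h = weak_order n r"
    using less_iff by (auto simp: weak_order_def)
  ultimately show ?thesis
    by (intro exI[of _ "inv' r"]) (auto simp: chamber_def permutes_inv permutes_inv_inv)
qed

text \<open>A face times a chamber is a chamber: the low digit of the lexicographic code is already
  injective.\<close>

lemma tits_prod_converse_chamber_ex:
  assumes "w permutes {1..n}"
  shows "\<exists>u. u permutes {1..n} \<and> tits_prod (weak_order n f) ((chamber n w)\<inverse>) = chamber n u"
proof -
  \<comment> \<open>Reversed positions lie between 1 and \<open>n\<close>, so \<open>n + 1\<close>
    can serve as the base and the digit is recovered modulo \<open>n + 1\<close>.\<close>
  define g where "g a = n + 1 - inv' w a" for a
  have inv_w: "inv' w a \<in> {1..n}" if "a \<in> {1..n}" for a
    using that permutes_in_image[OF permutes_inv[OF assms]] by blast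
  have inj_w: "inj (inv' w)"
    using permutes_inj[OF permutes_inv[OF assms]] .
  have g_less: "g a < g b \<longleftrightarrow> inv' w b < inv' w a" if "a \<in> {1..n}" "b \<in> {1..n}" for a b
    using inv_w[OF that(1)] inv_w[OF that(2)] by (auto simp: g_def)
  have g: "(chamber n w)\<inverse> = weak_order n g"
    using g_less by (auto simp: chamber_def weak_order_def)
  have g_bound: "g a < n + 1" if "a \<in> {1..n}" for a
    using inv_w[OF that] by (auto simp: g_def)
  have "inj_on (\<lambda>a. f a * (n + 1) + g a) {1..n}"
  proof (rule inj_onI)
    fix a b assume ab: "a \<in> {1..n}" "b \<in> {1..n}" "f a * (n + 1) + g a = f b * (n + 1) + g b"
    have "g a = (f a * (n + 1) + g a) mod (n + 1)" "g b = (f b * (n + 1) + g b) mod (n + 1)"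
      using g_bound[OF ab(1)] g_bound[OF ab(2)] by (simp_all only: mod_mult_self3 mod_less)
    then have "g a = g b" using ab(3) by metis
    then have "inv' w a = inv' w b"
      using g_less[OF ab(1,2)] g_less[OF ab(2,1)] by simp
    then show "a = b" using inj_w by (simp add: inj_eq)
  qed
  then show ?thesis
    using rank_permutation tits_prod_weak_order[of n g "n + 1" f] g g_bound by metis
qed

text \<open>The position of an element is one more than its number of predecessors, so the chamber
  determines the inverse permutation.\<close>

lemma chamber_inj:
  assumes "u permutes {1..n}" "w permutes {1..n}" "chamber n u = chamber n w"
  shows "u = w"
proof -
  have rank: "inv' v a = card {b. (b, a) \<in> chamber n v} + 1"
    if v: "v permutes {1..n}" and a: "a \<in> {1..n}" for v a
  proof -
    have "{b. (b, a) \<in> chamber n v} = v ` {1..<inv' v a}"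
    proof (intro Set.set_eqI iffI)
      fix b assume "b \<in> {b. (b, a) \<in> chamber n v}"
      then have "inv' v b \<in> {1..<inv' v a}"
        using permutes_in_image[OF permutes_inv[OF v], of b]
        by (auto simp: chamber_def weak_order_def)
      then show "b \<in> v ` {1..<inv' v a}"
        using permutes_inverses(1)[OF v, of b] by (metis imageI)
    next
      fix b assume "b \<in> v ` {1..<inv' v a}"
      then obtain i where i: "b = v i" "i \<in> {1..<inv' v a}" by blast
      have "inv' v a \<in> {1..n}" using permutes_in_image[OF permutes_inv[OF v]] a by blast
      then show "b \<in> {b. (b, a) \<in> chamber n v}"
        using i chamber_image_iff[OF v, of i "inv' v a"] permutes_inverses(1)[OF v, of a] by auto
    qed
    moreover have "card (v ` {1..<inv' v a}) = inv' v a - 1"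
      using card_image[OF inj_on_subset[OF permutes_inj[OF v] subset_UNIV]] by simp
    moreover have "inv' v a \<in> {1..n}" using permutes_in_image[OF permutes_inv[OF v]] a by blast
    ultimately show ?thesis by auto
  qed
  have "inv' u a = inv' w a" for a
  proof (cases "a \<in> {1..n}")
    case True
    then show ?thesis using rank assms by metis
  next
    case False
    then show ?thesis using permutes_not_in permutes_inv assms by metis
  qed
  then have "inv' u = inv' w" by blast
  then show ?thesis using permutes_inv_inv assms by metis
qed

section \<open>Descents and faces of a given type\<close>

abbreviation partial_sum :: "nat list \<Rightarrow> nat \<Rightarrow> nat"
  where "partial_sum \<alpha> j \<equiv> sum_list (take j \<alpha>)"

lemma partial_sum_Suc: "j < length \<alpha> \<Longrightarrow> partial_sum \<alpha> (Suc j) = partial_sum \<alpha> j + \<alpha> ! j"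
  by (simp add: take_Suc_conv_app_nth)

lemma partial_sum_mono: "i \<le> j \<Longrightarrow> partial_sum \<alpha> i \<le> partial_sum \<alpha> j"
proof (induction j rule: dec_induct)
  case (step j)
  then show ?case by (cases "j < length \<alpha>") (auto simp: partial_sum_Suc)
qed simp

lemma partial_sum_covers:
  "0 < a \<Longrightarrow> a \<le> partial_sum \<alpha> m \<Longrightarrow> m \<le> length \<alpha> \<Longrightarrow>
    \<exists>j<m. a \<in> {partial_sum \<alpha> j<..partial_sum \<alpha> (Suc j)}"
proof (induction m)
  case (Suc m)
  show ?case
  proof (cases "a \<le> partial_sum \<alpha> m")
    case True
    then show ?thesis using Suc less_SucI by fastforce
  next
    case False
    then show ?thesis using Suc.prems by (intro exI[of _ m]) auto
  qed
qed simp

text \<open>Positions count from 1 and blocks from 0: block \<open>j\<close> occupies the positions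
  after \<open>partial_sum \<alpha> j\<close> up to and including
  \<open>partial_sum \<alpha> (Suc j)\<close>.\<close>

definition block_index :: "nat list \<Rightarrow> nat \<Rightarrow> nat"
  where "block_index \<alpha> i = (LEAST j. i \<le> partial_sum \<alpha> (Suc j))"

text \<open>Replaces partial sums by a monotone step function. It jumps right after the last
  position of each block but the final one, and these last positions form
  \<open>comp_set \<alpha>\<close>.\<close>

lemma composition_block_index:
  assumes "is_composition n \<alpha>"
  defines "\<beta> \<equiv> block_index \<alpha>"
  shows "\<And>i j. i \<in> {1..n} \<Longrightarrow> j < length \<alpha> \<Longrightarrow>
      i \<in> {partial_sum \<alpha> j<..partial_sum \<alpha> (Suc j)} \<longleftrightarrow> \<beta> i = j"
    and "\<And>i. i \<in> {1..n} \<Longrightarrow> \<beta> i < length \<alpha>"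
    and "\<And>i j. i \<in> {1..n} \<Longrightarrow> j \<in> {1..n} \<Longrightarrow> i \<le> j \<Longrightarrow> \<beta> i \<le> \<beta> j"
    and "\<And>i. 1 \<le> i \<Longrightarrow> i < n \<Longrightarrow> i \<in> comp_set \<alpha> \<longleftrightarrow> \<beta> i < \<beta> (i + 1)"
proof -
  have \<beta>: "\<beta> i < length \<alpha> \<and> i \<in> {partial_sum \<alpha> (\<beta> i)<..partial_sum \<alpha> (Suc (\<beta> i))}"
    if i: "i \<in> {1..n}" for i
  proof -
    obtain j where j: "j < length \<alpha>" "i \<le> partial_sum \<alpha> (Suc j)"
      using partial_sum_covers[of i "length \<alpha>" \<alpha>] i assms(1) by (auto simp: is_composition_def)
    have "\<beta> i \<le> j" "i \<le> partial_sum \<alpha> (Suc (\<beta> i))"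
      unfolding \<beta>_def block_index_def using j(2) by (rule Least_le, rule LeastI)
    moreover have "partial_sum \<alpha> (\<beta> i) < i"
    proof (cases "\<beta> i")
      case 0
      then show ?thesis using i by simp
    next
      case (Suc k)
      then have "k < (LEAST j. i \<le> partial_sum \<alpha> (Suc j))" by (simp add: \<beta>_def block_index_def)
      then show ?thesis unfolding Suc by (meson not_less_Least not_le)
    qed
    ultimately show ?thesis using j(1) by simp
  qed
  \<comment> \<open>Used with equal positions for uniqueness of the block and with different ones
    for monotonicity.\<close>
  have le: "j \<le> \<beta> i'"
    if "i \<le> i'" "i \<in> {partial_sum \<alpha> j<..partial_sum \<alpha> (Suc j)}" "i' \<in> {1..n}" for i i' j
  proof (rule ccontr)
    assume "\<not> j \<le> \<beta> i'"
    then have "partial_sum \<alpha> (Suc (\<beta> i')) \<le> partial_sum \<alpha> j" by (intro partial_sum_mono) simp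
    then show False using \<beta>[OF that(3)] that by auto
  qed
  have ge: "\<beta> i \<le> j"
    if "i \<in> {1..n}" "i \<in> {partial_sum \<alpha> j<..partial_sum \<alpha> (Suc j)}" for i j
  proof (rule ccontr)
    assume "\<not> \<beta> i \<le> j"
    then have "partial_sum \<alpha> (Suc j) \<le> partial_sum \<alpha> (\<beta> i)" by (intro partial_sum_mono) simp
    then show False using \<beta>[OF that(1)] that by auto
  qed
  have comp: "i \<in> comp_set \<alpha> \<longleftrightarrow> \<beta> i < \<beta> (i + 1)" if i: "1 \<le> i" "i < n" for i
  proof
    assume "i \<in> comp_set \<alpha>"
    then obtain j where j: "i = partial_sum \<alpha> j" by (auto simp: comp_set_def)
    show "\<beta> i < \<beta> (i + 1)"
    proof (rule ccontr)
      assume "\<not> \<beta> i < \<beta> (i + 1)"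
      then have "\<beta> (i + 1) = \<beta> i"
        using le[of i "i + 1" "\<beta> i"] \<beta>[of i] i by auto
      \<comment> \<open>Two neighbours in one block would put the partial sum \<open>i\<close>
        strictly between consecutive partial sums.\<close>
      then have lt: "partial_sum \<alpha> (\<beta> i) < partial_sum \<alpha> j" "partial_sum \<alpha> j < partial_sum \<alpha> (Suc (\<beta> i))"
        using \<beta>[of i] \<beta>[of "i + 1"] i j by auto
      then have "\<not> j \<le> \<beta> i" "\<not> Suc (\<beta> i) \<le> j"
        using partial_sum_mono[of j "\<beta> i" \<alpha>] partial_sum_mono[of "Suc (\<beta> i)" j \<alpha>] by linarith+
      then show False by simp
    qed
  next
    assume less: "\<beta> i < \<beta> (i + 1)"
    then have "partial_sum \<alpha> (Suc (\<beta> i)) \<le> partial_sum \<alpha> (\<beta> (i + 1))"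
      by (intro partial_sum_mono) simp
    \<comment> \<open>This partial sum is at least \<open>i\<close> and less than
      \<open>i + 1\<close>.\<close>
    then have "i = partial_sum \<alpha> (\<beta> (i + 1))"
      using \<beta>[of i] \<beta>[of "i + 1"] i by auto
    then show "i \<in> comp_set \<alpha>"
      using \<beta>[of "i + 1"] i less unfolding comp_set_def by auto
  qed
  show "i \<in> {partial_sum \<alpha> j<..partial_sum \<alpha> (Suc j)} \<longleftrightarrow> \<beta> i = j"
    if "i \<in> {1..n}" "j < length \<alpha>" for i j
    using that le[of i i j] ge[of i j] \<beta>[of i] by auto
  show "\<beta> i < length \<alpha>" if "i \<in> {1..n}" for i
    using \<beta>[OF that] by blast
  show "\<beta> i \<le> \<beta> j" if "i \<in> {1..n}" "j \<in> {1..n}" "i \<le> j" for i j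
    using that le[of i j "\<beta> i"] \<beta>[of i] by blast
  show "i \<in> comp_set \<alpha> \<longleftrightarrow> \<beta> i < \<beta> (i + 1)" if "1 \<le> i" "i < n" for i
    using that by (rule comp)
qed

lemma down_closed_nat_eq_interval:
  assumes "finite D" "0 \<notin> D" "\<And>a b. b \<in> D \<Longrightarrow> 1 \<le> a \<Longrightarrow> a < b \<Longrightarrow> a \<in> D"
  shows "D = {1..card D}"
proof (cases "D = {}")
  case False
  then have "D = {1..Max D}"
  proof (intro equalityI subsetI)
    fix a assume "a \<in> {1..Max D}"
    then show "a \<in> D" using assms(3)[OF Max_in[OF assms(1) False], of a] Max_in[OF assms(1) False]
      by (cases "a = Max D") auto
  next
    fix a assume a: "a \<in> D"
    then have "a \<noteq> 0" using assms(2) by metis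
    then show "a \<in> {1..Max D}" using a assms(1) by auto
  qed
  then show ?thesis by (metis card_atLeastAtMost diff_Suc_1)
qed simp

text \<open>The union of the first \<open>j\<close> blocks occupies an initial segment of the positions of \<open>u\<close>, and its
  size is prescribed by \<open>\<alpha>\<close>.\<close>

lemma blocks_below_chamber:
  assumes G: "G \<in> set_compositions n" "sc_type G = \<alpha>" and u: "u permutes {1..n}"
    and below: "sc_order G \<subseteq> chamber n u"
  shows "G = map (\<lambda>j. u ` {partial_sum \<alpha> j<..partial_sum \<alpha> (Suc j)}) [0..<length \<alpha>]"
proof -
  have len: "length G = length \<alpha>" and card_G: "\<And>i. i < length G \<Longrightarrow> card (G ! i) = \<alpha> ! i"
    using G(2) by (auto simp: sc_type_def)
  have u_inv: "u (inv' u a) = a" "inv' u (u a) = a" for a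
    using permutes_inverses[OF u] by auto
  have inj: "inj u" and inj': "inj (inv' u)"
    using permutes_inj u permutes_inv by blast+
  define D where "D j = inv' u ` (\<Union>i<j. G ! i)" for j
  have sub: "(\<Union>i<j. G ! i) \<subseteq> {1..n}" if "j \<le> length G" for j
    using set_composition_block_subset[OF G(1)] that by (intro UN_least) auto
  have D_sub: "D j \<subseteq> {1..n}" if "j \<le> length G" for j
    using sub[OF that] permutes_in_image[OF permutes_inv[OF u]] unfolding D_def by blast
  have card_D: "card (D j) = partial_sum \<alpha> j" if "j \<le> length G" for j
    using that
  proof (induction j)
    case 0
    then show ?case by (simp add: D_def)
  next
    case (Suc j)
    have "D (Suc j) = inv' u ` (G ! j) \<union> D j"
      by (simp add: D_def lessThan_Suc image_Un)
    moreover have "inv' u ` (G ! j) \<inter> D j = {}"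
    proof -
      have "G ! j \<inter> G ! i = {}" if "i < j" for i
        using G(1) Suc.prems that by (auto simp: set_compositions_def)
      then have "G ! j \<inter> (\<Union>i<j. G ! i) = {}" by blast
      then show ?thesis unfolding D_def by (simp flip: image_Int[OF inj'])
    qed
    moreover have "finite (G ! j)" "finite (D j)"
      using set_composition_block_subset[OF G(1), of j] D_sub[of j] Suc.prems
      by (auto intro: finite_subset)
    moreover have "card (inv' u ` (G ! j)) = \<alpha> ! j"
      using card_image[OF inj_on_subset[OF inj' subset_UNIV]] card_G Suc.prems by simp
    ultimately show ?case
      using Suc len by (simp add: card_Un_disjoint partial_sum_Suc)
  qed
  have D_eq: "D j = {1..partial_sum \<alpha> j}" if j: "j \<le> length G" for j
  proof -
    have "D j = {1..card (D j)}"
    proof (rule down_closed_nat_eq_interval)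
      show "finite (D j)" "0 \<notin> D j"
        using D_sub[OF j] by (auto intro: finite_subset)
      fix a b assume b: "b \<in> D j" and a: "1 \<le> a" "a < b"
      obtain i where i: "i < j" "u b \<in> G ! i"
        using b u_inv by (auto simp: D_def)
      have "a \<in> {1..n}" using a b D_sub[OF j] by fastforce
      then have "u a \<in> {1..n}" using permutes_in_image[OF u] by blast
      then obtain k where k: "k < length G" "u a \<in> G ! k"
        using set_composition_block[OF G(1)] by blast
      \<comment> \<open>Otherwise \<open>u b\<close> precedes \<open>u a\<close> in
        \<open>G\<close>, hence in the chamber, against \<open>a < b\<close>.\<close>
      have "k < j"
      proof (rule ccontr)
        assume "\<not> k < j"
        then have "i < k" using i(1) by simp
        then have "(u b, u a) \<in> sc_order G" using i(2) k unfolding sc_order_def by blast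
        then have "b < a" using below chamber_image_iff[OF u, of b a] by blast
        then show False using a(2) by simp
      qed
      then have "inv' u (u a) \<in> D j" using k unfolding D_def by blast
      then show "a \<in> D j" by (simp add: u_inv)
    qed
    then show ?thesis using card_D[OF j] by simp
  qed
  have union: "(\<Union>i<j. G ! i) = u ` {1..partial_sum \<alpha> j}" if "j \<le> length G" for j
    using D_eq[OF that, symmetric] by (simp add: D_def image_image u_inv)
  show ?thesis
  proof (rule nth_equalityI)
    fix j assume j: "j < length G"
    have "G ! j \<inter> G ! i = {}" if "i < j" for i
      using G(1) j that by (auto simp: set_compositions_def)
    then have "G ! j = (\<Union>i<Suc j. G ! i) - (\<Union>i<j. G ! i)"
      by (auto simp: lessThan_Suc)
    also have "\<dots> = u ` ({1..partial_sum \<alpha> (Suc j)} - {1..partial_sum \<alpha> j})"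
      using j by (simp only: union Suc_leI less_imp_le image_set_diff[OF inj])
    also have "{1..partial_sum \<alpha> (Suc j)} - {1..partial_sum \<alpha> j} =
        {partial_sum \<alpha> j<..partial_sum \<alpha> (Suc j)}"
      by auto
    finally show "G ! j = map (\<lambda>j. u ` {partial_sum \<alpha> j<..partial_sum \<alpha> (Suc j)}) [0..<length \<alpha>] ! j"
      using j len by simp
  qed (simp add: len)
qed

text \<open>Cuts the word of \<open>u\<close> into consecutive segments of lengths \<alpha>: the
  existence counterpart of the uniqueness in \<open>blocks_below_chamber\<close>.\<close>

lemma chamber_blocks_set_composition:
  assumes "is_composition n \<alpha>" "u permutes {1..n}"
  defines "G \<equiv> map (\<lambda>j. u ` {partial_sum \<alpha> j<..partial_sum \<alpha> (Suc j)}) [0..<length \<alpha>]"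
  shows "G \<in> set_compositions n" "sc_type G = \<alpha>"
proof -
  have inj: "inj u" using permutes_inj assms(2) by blast
  have len: "length G = length \<alpha>" by (simp add: G_def)
  have G_nth: "G ! j = u ` {partial_sum \<alpha> j<..partial_sum \<alpha> (Suc j)}" if "j < length \<alpha>" for j
    using that by (simp add: G_def)
  have card_G: "card (G ! j) = \<alpha> ! j" if "j < length \<alpha>" for j
    using that card_image[OF inj_on_subset[OF inj subset_UNIV]] by (simp add: G_nth partial_sum_Suc)
  show type: "sc_type G = \<alpha>"
    by (rule nth_equalityI) (use card_G len in \<open>auto simp: sc_type_def\<close>)
  define \<beta> where "\<beta> = block_index \<alpha>"
  note \<beta> = composition_block_index(1)[OF assms(1), folded \<beta>_def]
    and \<beta>_less = composition_block_index(2)[OF assms(1), folded \<beta>_def]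
  have range: "{partial_sum \<alpha> j<..partial_sum \<alpha> (Suc j)} \<subseteq> {1..n}" if "j < length \<alpha>" for j
    using partial_sum_mono[of "Suc j" "length \<alpha>" \<alpha>] that assms(1)
    by (auto simp: is_composition_def)
  show "G \<in> set_compositions n"
    unfolding set_compositions_def
  proof (intro CollectI conjI ballI allI impI)
    fix A assume "A \<in> set G"
    then obtain j where j: "j < length \<alpha>" "A = G ! j" using len by (metis in_set_conv_nth)
    then have "card A > 0" using card_G assms(1) by (simp add: is_composition_def)
    then show "A \<noteq> {}" by auto
  next
    fix i j assume ij: "i < length G" "j < length G" "i \<noteq> j"
    have "{partial_sum \<alpha> i<..partial_sum \<alpha> (Suc i)} \<inter> {partial_sum \<alpha> j<..partial_sum \<alpha> (Suc j)} = {}"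
    proof (rule ccontr)
      assume "\<not> ?thesis"
      then obtain a where a: "a \<in> {partial_sum \<alpha> i<..partial_sum \<alpha> (Suc i)}"
        "a \<in> {partial_sum \<alpha> j<..partial_sum \<alpha> (Suc j)}" by blast
      have il: "i < length \<alpha>" "j < length \<alpha>" using ij len by auto
      have an: "a \<in> {1..n}" using range[OF il(1)] a(1) by blast
      have "\<beta> a = i" "\<beta> a = j"
        using \<beta>[OF an il(1)] \<beta>[OF an il(2)] a by blast+
      then show False using ij(3) by simp
    qed
    then show "G ! i \<inter> G ! j = {}"
      using ij len by (simp add: G_nth flip: image_Int[OF inj])
  next
    have "(\<Union>j<length \<alpha>. {partial_sum \<alpha> j<..partial_sum \<alpha> (Suc j)}) = {1..n}"
    proof (intro equalityI UN_least subsetI)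
      fix a assume "a \<in> {1..n}"
      then show "a \<in> (\<Union>j<length \<alpha>. {partial_sum \<alpha> j<..partial_sum \<alpha> (Suc j)})"
        using \<beta>[of a "\<beta> a"] \<beta>_less[of a] by blast
    qed (use range in blast)
    then have "u ` (\<Union>j<length \<alpha>. {partial_sum \<alpha> j<..partial_sum \<alpha> (Suc j)}) = {1..n}"
      using permutes_image[OF assms(2)] by simp
    moreover have "\<Union> (set G) = u ` (\<Union>j<length \<alpha>. {partial_sum \<alpha> j<..partial_sum \<alpha> (Suc j)})"
      by (simp add: G_def image_UN atLeast0LessThan)
    ultimately show "\<Union> (set G) = {1..n}" by simp
  qed
qed

text \<open>Read along the positions of \<open>u\<close>, the product sorts by block and, inside a
  block, by decreasing values of the permutation \<open>inv' y \<circ> u\<close>. It agrees with the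
  chamber of \<open>u\<close> exactly when this permutation decreases inside each block; its
  ascents, which \<open>longest_perm n\<close> turns into descents, then occur only at block
  ends.\<close>

lemma tits_prod_chamber_blocks_iff:
  assumes \<alpha>: "is_composition n \<alpha>" and u: "u permutes {1..n}" and y: "y permutes {1..n}"
  defines "G \<equiv> map (\<lambda>j. u ` {partial_sum \<alpha> j<..partial_sum \<alpha> (Suc j)}) [0..<length \<alpha>]"
  shows "tits_prod (sc_order G) ((chamber n y)\<inverse>) = chamber n u \<longleftrightarrow>
    Des n (longest_perm n \<circ> (inv' y \<circ> u)) \<subseteq> comp_set \<alpha>"
proof -
  define \<beta> where "\<beta> = block_index \<alpha>"
  note \<beta> = composition_block_index(1)[OF \<alpha>, folded \<beta>_def]
    and \<beta>_less = composition_block_index(2)[OF \<alpha>, folded \<beta>_def]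
    and \<beta>_mono = composition_block_index(3)[OF \<alpha>, folded \<beta>_def]
    and \<beta>_comp = composition_block_index(4)[OF \<alpha>, folded \<beta>_def]
  define c where "c = inv' y \<circ> u"
  have c: "c permutes {1..n}"
    unfolding c_def using permutes_compose[OF u permutes_inv[OF y]] .
  have inj: "inj u" using permutes_inj u by blast
  have u_in: "u i \<in> {1..n} \<longleftrightarrow> i \<in> {1..n}" for i
    using permutes_in_image[OF u] .
  have G: "(u i, u j) \<in> sc_order G \<longleftrightarrow> \<beta> i < \<beta> j" if ij: "i \<in> {1..n}" "j \<in> {1..n}" for i j
  proof -
    have mem: "u i \<in> G ! k \<longleftrightarrow> \<beta> i = k" if "k < length \<alpha>" "i \<in> {1..n}" for k i
      using that \<beta>[of i k] by (simp add: G_def inj_image_mem_iff[OF inj])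
    have len: "length G = length \<alpha>" by (simp add: G_def)
    show ?thesis
    proof
      assume "(u i, u j) \<in> sc_order G"
      then obtain k l where kl: "k < l" "l < length \<alpha>" "u i \<in> G ! k" "u j \<in> G ! l"
        by (auto simp: sc_order_def len)
      then show "\<beta> i < \<beta> j" using mem[of k i] mem[of l j] ij by simp
    next
      assume "\<beta> i < \<beta> j"
      then show "(u i, u j) \<in> sc_order G"
        using mem[OF \<beta>_less[OF ij(1)] ij(1)] mem[OF \<beta>_less[OF ij(2)] ij(2)] \<beta>_less[OF ij(2)]
        unfolding sc_order_def len by blast
    qed
  qed
  have G_sub: "sc_order G \<subseteq> {1..n} \<times> {1..n}"
    using sc_order_is_weak_order[OF chamber_blocks_set_composition(1)[OF \<alpha> u]]
    unfolding G_def by (auto simp: weak_order_def)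
  have prod_iff: "(u i, u j) \<in> tits_prod (sc_order G) ((chamber n y)\<inverse>) \<longleftrightarrow>
      \<beta> i < \<beta> j \<or> \<beta> i = \<beta> j \<and> c j < c i" if ij: "i \<in> {1..n}" "j \<in> {1..n}" for i j
  proof -
    have "(u j, u i) \<in> chamber n y \<longleftrightarrow> c j < c i"
      using ij u_in by (auto simp: chamber_def weak_order_def c_def)
    then show ?thesis
      unfolding tits_prod_def using G[of i j] G[of j i] ij by auto
  qed
  \<comment> \<open>Both relations live on the interval, which \<open>u\<close> permutes, so they
    may be compared at positions.\<close>
  have "tits_prod (sc_order G) ((chamber n y)\<inverse>) = chamber n u \<longleftrightarrow>
      (\<forall>i\<in>{1..n}. \<forall>j\<in>{1..n}. (u i, u j) \<in> tits_prod (sc_order G) ((chamber n y)\<inverse>) \<longleftrightarrow>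
        (u i, u j) \<in> chamber n u)" (is "?P = ?C \<longleftrightarrow> ?R")
  proof
    assume R: ?R
    have sub: "?P \<subseteq> {1..n} \<times> {1..n}" "?C \<subseteq> {1..n} \<times> {1..n}"
      using G_sub by (auto simp: tits_prod_def chamber_def weak_order_def)
    have surj: "\<exists>i\<in>{1..n}. a = u i" if "a \<in> {1..n}" for a
      using permutes_image[OF u] that by blast
    have "(a, b) \<in> ?P \<longleftrightarrow> (a, b) \<in> ?C" for a b
    proof (cases "a \<in> {1..n} \<and> b \<in> {1..n}")
      case True
      then show ?thesis using surj R by blast
    next
      case False
      then show ?thesis using sub by blast
    qed
    then show "?P = ?C" by auto
  qed simp
  also have "\<dots> \<longleftrightarrow> (\<forall>i\<in>{1..n}. \<forall>j\<in>{1..n}. (\<beta> i < \<beta> j \<or> \<beta> i = \<beta> j \<and> c j < c i) \<longleftrightarrow> i < j)"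
    using prod_iff chamber_image_iff[OF u] by (intro ball_cong refl) blast
  \<comment> \<open>Blocks are intervals of positions, so inequalities between neighbours chain
    together.\<close>
  also have "\<dots> \<longleftrightarrow> (\<forall>i. 1 \<le> i \<and> i < n \<and> \<beta> i = \<beta> (i + 1) \<longrightarrow> c (i + 1) < c i)"
  proof
    assume *: "\<forall>i\<in>{1..n}. \<forall>j\<in>{1..n}. (\<beta> i < \<beta> j \<or> \<beta> i = \<beta> j \<and> c j < c i) \<longleftrightarrow> i < j"
    show "\<forall>i. 1 \<le> i \<and> i < n \<and> \<beta> i = \<beta> (i + 1) \<longrightarrow> c (i + 1) < c i"
    proof (intro allI impI)
      fix i assume i: "1 \<le> i \<and> i < n \<and> \<beta> i = \<beta> (i + 1)"
      then have "i \<in> {1..n}" "i + 1 \<in> {1..n}" by auto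
      then show "c (i + 1) < c i" using * i by fastforce
    qed
  next
    assume *: "\<forall>i. 1 \<le> i \<and> i < n \<and> \<beta> i = \<beta> (i + 1) \<longrightarrow> c (i + 1) < c i"
    have less: "c j < c i" if "i < j" "i \<in> {1..n}" "j \<in> {1..n}" "\<beta> i = \<beta> j" for i j
      using that
    proof (induction j)
      case 0
      then show ?case by simp
    next
      case (Suc j)
      show ?case
      proof (cases "i = j")
        case True
        then show ?thesis using * Suc.prems by auto
      next
        case False
        then have j: "i < j" "j \<in> {1..n}" using Suc.prems by auto
        \<comment> \<open>A monotone index equal at \<open>i\<close> and \<open>Suc j\<close> is
          constant in between.\<close>
        then have "\<beta> i \<le> \<beta> j" "\<beta> j \<le> \<beta> (Suc j)"
          using \<beta>_mono[of i j] \<beta>_mono[of j "Suc j"] Suc.prems(2,3) by auto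
        then have "\<beta> j = \<beta> (j + 1)" "\<beta> i = \<beta> j" using Suc.prems by auto
        moreover have "1 \<le> j" "j < n" using j Suc.prems(3) by auto
        ultimately have "c (j + 1) < c j" using * by blast
        also have "c j < c i" using Suc.IH[OF j(1) Suc.prems(2) j(2)] \<open>\<beta> i = \<beta> j\<close> by blast
        finally show ?thesis by simp
      qed
    qed
    show "\<forall>i\<in>{1..n}. \<forall>j\<in>{1..n}. (\<beta> i < \<beta> j \<or> \<beta> i = \<beta> j \<and> c j < c i) \<longleftrightarrow> i < j"
    proof (intro ballI)
      fix i j assume ij: "i \<in> {1..n}" "j \<in> {1..n}"
      show "(\<beta> i < \<beta> j \<or> \<beta> i = \<beta> j \<and> c j < c i) \<longleftrightarrow> i < j"
        using less[of i j] less[of j i] \<beta>_mono[of i j] \<beta>_mono[of j i] ij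
        by (cases i j rule: linorder_cases) auto
    qed
  qed
  also have "\<dots> \<longleftrightarrow> Des n (longest_perm n \<circ> c) \<subseteq> comp_set \<alpha>"
  proof -
    \<comment> \<open>\<open>longest_perm n\<close> reverses values, and injectivity of
      \<open>c\<close> excludes ties.\<close>
    have des: "i \<in> Des n (longest_perm n \<circ> c) \<longleftrightarrow> \<not> c (i + 1) < c i" if i: "1 \<le> i" "i < n" for i
    proof -
      have "c i \<in> {1..n}" "c (i + 1) \<in> {1..n}" "c i \<noteq> c (i + 1)"
        using permutes_in_image[OF c] i inj_eq[OF permutes_inj[OF c]] by auto
      then show ?thesis using i by (auto simp: Des_def longest_perm_def)
    qed
    have "\<beta> i = \<beta> (i + 1) \<longleftrightarrow> i \<notin> comp_set \<alpha>" if "1 \<le> i" "i < n" for i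
      using \<beta>_comp[OF that] \<beta>_mono[of i "i + 1"] that by auto
    moreover have "Des n (longest_perm n \<circ> c) \<subseteq> {1..<n}" by (auto simp: Des_def)
    ultimately show ?thesis using des by (auto simp: subset_iff)
  qed
  finally show ?thesis unfolding c_def .
qed

text \<open>A face with this product lies below the chamber of \<open>u\<close>, so it can only be
  the cut of \<open>u\<close> along \<alpha>; the count is therefore 0 or 1.\<close>

lemma card_tits_prod_eq_chamber:
  assumes "is_composition n \<alpha>" "u permutes {1..n}" "y permutes {1..n}"
  shows "card {G \<in> set_compositions n. sc_type G = \<alpha> \<and>
      tits_prod (sc_order G) ((chamber n y)\<inverse>) = chamber n u} =
    of_bool (Des n (longest_perm n \<circ> (inv' y \<circ> u)) \<subseteq> comp_set \<alpha>)"
proof -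
  define G where "G = map (\<lambda>j. u ` {partial_sum \<alpha> j<..partial_sum \<alpha> (Suc j)}) [0..<length \<alpha>]"
  have G: "G \<in> set_compositions n" "sc_type G = \<alpha>"
    using chamber_blocks_set_composition[OF assms(1,2)] by (auto simp: G_def)
  have unique: "H = G" if "H \<in> set_compositions n" "sc_type H = \<alpha>"
      "tits_prod (sc_order H) ((chamber n y)\<inverse>) = chamber n u" for H
  proof -
    have "sc_order H \<subseteq> chamber n u" using that(3) by (auto simp: tits_prod_def)
    then show ?thesis unfolding G_def using blocks_below_chamber that assms(2) by blast
  qed
  have "{H \<in> set_compositions n. sc_type H = \<alpha> \<and>
      tits_prod (sc_order H) ((chamber n y)\<inverse>) = chamber n u} =
    (if tits_prod (sc_order G) ((chamber n y)\<inverse>) = chamber n u then {G} else {})" (is "?S = _")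
  proof (cases "tits_prod (sc_order G) ((chamber n y)\<inverse>) = chamber n u")
    case True
    then have "?S = {G}" using G unique by blast
    then show ?thesis using True by simp
  next
    case False
    then have "?S = {}" using unique by blast
    then show ?thesis using False by simp
  qed
  then show ?thesis
    using tits_prod_chamber_blocks_iff[OF assms] by (simp add: G_def)
qed

section \<open>The annihilating polynomial\<close>

text \<open>The coefficients of \<open>w\<^sub>0 B\<^sub>\<alpha>\<close>, as \<open>w\<^sub>0\<close> is an involution.\<close>

definition w0B_coeff :: "nat \<Rightarrow> nat list \<Rightarrow> (nat \<Rightarrow> nat) \<Rightarrow> int"
  where "w0B_coeff n \<alpha> v = of_bool (Des n (longest_perm n \<circ> v) \<subseteq> comp_set \<alpha>)"

text \<open>When \<open>Q C\<close> is \<open>tits_prod P C = U\<close>, this is the coefficient of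
  \<open>U\<close> in the product of \<open>P\<close> with the combination \<open>v\<close> of
  chambers.\<close>

definition chamber_sum ::
  "nat \<Rightarrow> ((nat \<times> nat) set \<Rightarrow> bool) \<Rightarrow> ((nat \<Rightarrow> nat) \<Rightarrow> int) \<Rightarrow> int"
  where "chamber_sum n Q v = (\<Sum>w\<in>carrier (sym_group n). of_bool (Q (chamber n w)) * v w)"

lemma finite_carrier_sym_group: "finite (carrier (sym_group n))"
  by (simp add: sym_group_def finite_permutations)

lemma chamber_sum_cong:
  "(\<And>w. w \<in> carrier (sym_group n) \<Longrightarrow> v w = v' w) \<Longrightarrow> chamber_sum n Q v = chamber_sum n Q v'"
  by (simp add: chamber_sum_def)

lemma chamber_sum_diff:
  "chamber_sum n Q (\<lambda>w. v w - c * v' w) = chamber_sum n Q v - c * chamber_sum n Q v'"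
  by (simp add: chamber_sum_def algebra_simps sum_subtractf sum_distrib_left)

lemma chamber_sum_eq_chamber:
  assumes "u \<in> carrier (sym_group n)"
  shows "chamber_sum n (\<lambda>C. C = chamber n u) v = v u"
proof -
  have "chamber_sum n (\<lambda>C. C = chamber n u) v =
      (\<Sum>w\<in>carrier (sym_group n). if w = u then v w else 0)"
    unfolding chamber_sum_def using assms chamber_inj
    by (intro sum.cong) (auto simp: sym_group_carrier)
  then show ?thesis using assms by (simp add: finite_carrier_sym_group)
qed

text \<open>Writes an entry of the matrix of right multiplication as a sum over faces, so that this
  sum can be pulled outside.\<close>

lemma w0B_coeff_eq_card:
  assumes "is_composition n \<alpha>" "y \<in> carrier (sym_group n)" "u \<in> carrier (sym_group n)"
  shows "w0B_coeff n \<alpha> (inv\<^bsub>sym_group n\<^esub> y \<otimes>\<^bsub>sym_group n\<^esub> u) =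
    (\<Sum>G | G \<in> set_compositions n \<and> sc_type G = \<alpha>.
      of_bool (tits_prod (sc_order G) ((chamber n y)\<inverse>) = chamber n u))"
proof -
  have "w0B_coeff n \<alpha> (inv\<^bsub>sym_group n\<^esub> y \<otimes>\<^bsub>sym_group n\<^esub> u) =
      int (card {G \<in> {G \<in> set_compositions n. sc_type G = \<alpha>}.
        tits_prod (sc_order G) ((chamber n y)\<inverse>) = chamber n u})"
    using card_tits_prod_eq_chamber[of n \<alpha> u y] assms
    by (simp add: w0B_coeff_def sym_group_carrier sym_group_mult conj_assoc)
  then show ?thesis
    using finite_set_compositions_of_type[of n \<alpha>] by (simp add: of_bool_def sum.If_cases Int_def)
qed

text \<open>Right multiplication by \<open>w\<^sub>0 B\<^sub>\<alpha>\<close> sends a chamber \<open>C\<close> to the sum of the products \<open>G C\<^sup>-\<close>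
  over all faces \<open>G\<close> of type \<open>\<alpha>\<close>, where \<open>C\<^sup>-\<close> is the reversed chamber.\<close>

lemma chamber_sum_convolution_w0B:
  assumes "is_composition n \<alpha>"
  shows "chamber_sum n Q (convolution (sym_group n) v (w0B_coeff n \<alpha>)) =
    (\<Sum>G | G \<in> set_compositions n \<and> sc_type G = \<alpha>.
      chamber_sum n (\<lambda>C. Q (tits_prod (sc_order G) (C\<inverse>))) v)"
proof -
  define S where "S = carrier (sym_group n)"
  define \<G> where "\<G> = {G. G \<in> set_compositions n \<and> sc_type G = \<alpha>}"
  define H where "H G y = tits_prod (sc_order G) ((chamber n y)\<inverse>)" for G y
  \<comment> \<open>The product is itself a chamber, so exactly one \<open>u\<close>
    contributes.\<close>
  have count: "(\<Sum>u\<in>S. of_bool (Q (chamber n u)) * of_bool (H G y = chamber n u)) =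
      (of_bool (Q (H G y)) :: int)" if G: "G \<in> \<G>" and y: "y \<in> S" for G y
  proof -
    obtain g where g: "sc_order G = weak_order n g"
      using G sc_order_is_weak_order[of G n] by (auto simp: \<G>_def)
    obtain u0 where u0: "u0 \<in> S" "H G y = chamber n u0"
      using tits_prod_converse_chamber_ex[of y n g] y g by (auto simp: S_def H_def sym_group_carrier)
    have "(\<Sum>u\<in>S. of_bool (Q (chamber n u)) * of_bool (H G y = chamber n u)) =
        (\<Sum>u\<in>S. if u = u0 then of_bool (Q (H G y)) else (0 :: int))"
      using u0 chamber_inj by (intro sum.cong) (auto simp: S_def sym_group_carrier)
    then show ?thesis using u0(1) by (simp add: S_def finite_carrier_sym_group)
  qed
  have "chamber_sum n Q (convolution (sym_group n) v (w0B_coeff n \<alpha>)) =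
      (\<Sum>u\<in>S. \<Sum>y\<in>S. \<Sum>G\<in>\<G>. v y * (of_bool (Q (chamber n u)) * of_bool (H G y = chamber n u)))"
    unfolding chamber_sum_def convolution_def S_def \<G>_def H_def using assms
    by (simp add: w0B_coeff_eq_card sum_distrib_left mult.left_commute del: sym_group_inv_equality)
  also have "\<dots> = (\<Sum>y\<in>S. \<Sum>u\<in>S. \<Sum>G\<in>\<G>. v y * (of_bool (Q (chamber n u)) * of_bool (H G y = chamber n u)))"
    by (rule sum.swap)
  also have "\<dots> = (\<Sum>y\<in>S. \<Sum>G\<in>\<G>. \<Sum>u\<in>S. v y * (of_bool (Q (chamber n u)) * of_bool (H G y = chamber n u)))"
    by (intro sum.cong refl sum.swap)
  also have "\<dots> = (\<Sum>y\<in>S. \<Sum>G\<in>\<G>. of_bool (Q (H G y)) * v y)"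
  proof (intro sum.cong refl)
    fix y G assume "y \<in> S" "G \<in> \<G>"
    then show "(\<Sum>u\<in>S. v y * (of_bool (Q (chamber n u)) * of_bool (H G y = chamber n u))) =
        of_bool (Q (H G y)) * v y"
      by (simp only: sum_distrib_left[symmetric] count mult.commute)
  qed
  also have "\<dots> = (\<Sum>G\<in>\<G>. \<Sum>y\<in>S. of_bool (Q (H G y)) * v y)"
    by (rule sum.swap)
  finally show ?thesis
    by (simp add: chamber_sum_def S_def \<G>_def H_def)
qed

text \<open>In the face algebra extended by the reversal \<open>s\<close> these conditions say that \<open>P v = 0\<close> and
  \<open>P s v = 0\<close>.\<close>

definition face_annihilates ::
  "nat \<Rightarrow> (nat \<times> nat) set \<Rightarrow> ((nat \<Rightarrow> nat) \<Rightarrow> int) \<Rightarrow> bool"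
  where "face_annihilates n P v \<longleftrightarrow>
    (\<forall>U. chamber_sum n (\<lambda>C. tits_prod P C = U) v = 0 \<and>
         chamber_sum n (\<lambda>C. tits_prod P (C\<inverse>) = U) v = 0)"

lemma face_annihilates_cong:
  "(\<And>w. w \<in> carrier (sym_group n) \<Longrightarrow> v w = v' w) \<Longrightarrow> face_annihilates n P v = face_annihilates n P v'"
  unfolding face_annihilates_def using chamber_sum_cong[of n v v'] by simp

text \<open>The filtration by \<open>refine_count\<close>, seen through its annihilators; lowering
  \<open>j\<close> strengthens the condition.\<close>

definition annihilated_above :: "nat \<Rightarrow> nat list \<Rightarrow> nat \<Rightarrow> ((nat \<Rightarrow> nat) \<Rightarrow> int) \<Rightarrow> bool"
  where "annihilated_above n \<alpha> j v \<longleftrightarrow>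
    (\<forall>f. j < refine_count n \<alpha> (weak_order n f) \<longrightarrow> face_annihilates n (weak_order n f) v)"

text \<open>Associativity moves \<open>G\<close> from the chamber to \<open>P\<close>. Since
  reversal is an automorphism, it exchanges the sums over chambers with those over reversed
  chambers.\<close>

lemma face_sum_convolution_w0B:
  assumes "is_composition n \<alpha>"
  shows "chamber_sum n (\<lambda>C. tits_prod P C = U) (convolution (sym_group n) v (w0B_coeff n \<alpha>)) =
      (\<Sum>G | G \<in> set_compositions n \<and> sc_type G = \<alpha>.
        chamber_sum n (\<lambda>C. tits_prod (tits_prod P (sc_order G)) (C\<inverse>) = U) v)"
    and "chamber_sum n (\<lambda>C. tits_prod P (C\<inverse>) = U) (convolution (sym_group n) v (w0B_coeff n \<alpha>)) =
      (\<Sum>G | G \<in> set_compositions n \<and> sc_type G = \<alpha>.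
        chamber_sum n (\<lambda>C. tits_prod (tits_prod P ((sc_order G)\<inverse>)) C = U) v)"
  by (simp_all only: chamber_sum_convolution_w0B[OF assms] tits_prod_assoc converse_tits_prod
      converse_converse)

text \<open>A face that is not absorbed raises the count, which leads into the part known to kill
  \<open>v\<close>.\<close>

lemma face_annihilates_tits_prod:
  assumes v: "annihilated_above n \<alpha> (refine_count n \<alpha> (weak_order n f)) v"
    and G: "G \<in> set_compositions n" "sc_type G = \<alpha>"
    and not_sub: "\<not> sc_order G \<subseteq> weak_order n f \<union> (weak_order n f)\<inverse>"
    and Q: "Q = sc_order G \<or> Q = (sc_order G)\<inverse>"
  shows "face_annihilates n (tits_prod (weak_order n f) Q) v"
proof -
  obtain g where g: "Q = weak_order n g"
    using sc_order_is_weak_order[OF G(1)] converse_weak_order_ex Q by metis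
  obtain h where h: "tits_prod (weak_order n f) Q = weak_order n h"
    using tits_prod_weak_order_ex g by metis
  then have "refine_count n \<alpha> (weak_order n f) < refine_count n \<alpha> (weak_order n h)"
    using refine_count_tits_prod_less[OF G not_sub Q] by simp
  then show ?thesis
    using v h by (simp add: annihilated_above_def)
qed

text \<open>Only the faces \<open>G\<close> absorbed by \<open>P\<close> contribute, each giving the
  same term, and there are \<open>refine_count n \<alpha> P\<close> of them.\<close>

lemma face_sum_convolution_w0B_lowest:
  assumes \<alpha>: "is_composition n \<alpha>"
    and v: "annihilated_above n \<alpha> (refine_count n \<alpha> (weak_order n f)) v"
  defines "P \<equiv> weak_order n f" and "Tv \<equiv> convolution (sym_group n) v (w0B_coeff n \<alpha>)"
  shows "chamber_sum n (\<lambda>C. tits_prod P C = U) Tv =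
      int (refine_count n \<alpha> P) * chamber_sum n (\<lambda>C. tits_prod P (C\<inverse>) = U) v"
    and "chamber_sum n (\<lambda>C. tits_prod P (C\<inverse>) = U) Tv =
      int (refine_count n \<alpha> P) * chamber_sum n (\<lambda>C. tits_prod P C = U) v"
proof -
  \<comment> \<open>Serves both claims: \<open>t\<close> is a coefficient functional vanishing on
    faces that kill \<open>v\<close>, and \<open>c\<close> is the optional reversal.\<close>
  have absorb: "(\<Sum>G | G \<in> set_compositions n \<and> sc_type G = \<alpha>. t (tits_prod P (c (sc_order G)))) =
      int (refine_count n \<alpha> P) * t P"
    if t: "\<And>R. face_annihilates n R v \<Longrightarrow> t R = 0" and c: "c = (\<lambda>R. R) \<or> c = converse"
    for t :: "(nat \<times> nat) set \<Rightarrow> int" and c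
  proof -
    have "(\<Sum>G | G \<in> set_compositions n \<and> sc_type G = \<alpha>. t (tits_prod P (c (sc_order G)))) =
        (\<Sum>G | G \<in> set_compositions n \<and> sc_type G = \<alpha>.
          if sc_order G \<subseteq> P \<union> P\<inverse> then t P else 0)"
    proof (intro sum.cong refl)
      fix G assume G: "G \<in> {G. G \<in> set_compositions n \<and> sc_type G = \<alpha>}"
      show "t (tits_prod P (c (sc_order G))) = (if sc_order G \<subseteq> P \<union> P\<inverse> then t P else 0)"
      proof (cases "sc_order G \<subseteq> P \<union> P\<inverse>")
        case True
        then have "c (sc_order G) \<subseteq> P \<union> P\<inverse>" using c by auto
        then show ?thesis using True by (simp add: tits_prod_absorb)
      next
        case False
        then have "face_annihilates n (tits_prod P (c (sc_order G))) v"
          unfolding P_def using G c by (intro face_annihilates_tits_prod[OF v, of G]) auto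
        then show ?thesis using False t by simp
      qed
    qed
    also have "\<dots> = int (refine_count n \<alpha> P) * t P"
      using finite_set_compositions_of_type[of n \<alpha>]
      by (simp add: refine_count_def sum.If_cases Int_def conj_assoc)
    finally show ?thesis .
  qed
  show "chamber_sum n (\<lambda>C. tits_prod P C = U) Tv =
      int (refine_count n \<alpha> P) * chamber_sum n (\<lambda>C. tits_prod P (C\<inverse>) = U) v"
    unfolding Tv_def face_sum_convolution_w0B(1)[OF \<alpha>]
    by (rule absorb[where c = "\<lambda>R. R" and t = "\<lambda>R. chamber_sum n (\<lambda>C. tits_prod R (C\<inverse>) = U) v"])
      (auto simp: face_annihilates_def)
  show "chamber_sum n (\<lambda>C. tits_prod P (C\<inverse>) = U) Tv =
      int (refine_count n \<alpha> P) * chamber_sum n (\<lambda>C. tits_prod P C = U) v"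
    unfolding Tv_def face_sum_convolution_w0B(2)[OF \<alpha>]
    by (rule absorb[where c = converse and t = "\<lambda>R. chamber_sum n (\<lambda>C. tits_prod R C = U) v"])
      (auto simp: face_annihilates_def)
qed

lemma annihilated_above_mono: "annihilated_above n \<alpha> i v \<Longrightarrow> i \<le> j \<Longrightarrow> annihilated_above n \<alpha> j v"
  by (auto simp: annihilated_above_def)

text \<open>The new sums are multiples of the old ones, which vanish.\<close>

lemma annihilated_above_convolution_w0B:
  assumes "is_composition n \<alpha>" "annihilated_above n \<alpha> j v"
  shows "annihilated_above n \<alpha> j (convolution (sym_group n) v (w0B_coeff n \<alpha>))"
  unfolding annihilated_above_def
proof (intro allI impI)
  fix f assume j: "j < refine_count n \<alpha> (weak_order n f)"
  have "annihilated_above n \<alpha> (refine_count n \<alpha> (weak_order n f)) v"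
    using annihilated_above_mono[OF assms(2)] j by simp
  moreover have "face_annihilates n (weak_order n f) v"
    using assms(2) j by (simp add: annihilated_above_def)
  ultimately show "face_annihilates n (weak_order n f) (convolution (sym_group n) v (w0B_coeff n \<alpha>))"
    using face_sum_convolution_w0B_lowest[OF assms(1)] by (simp add: face_annihilates_def)
qed

text \<open>At count \<open>k\<close> each convolution swaps the two kinds of sums and contributes a
  factor \<open>k\<close>, so two of them cancel against the subtracted square; at larger counts
  both terms vanish.\<close>

lemma face_annihilates_quadratic:
  assumes \<alpha>: "is_composition n \<alpha>" and v: "annihilated_above n \<alpha> k v"
    and k: "k \<le> refine_count n \<alpha> (weak_order n f)"
  shows "face_annihilates n (weak_order n f) (\<lambda>w. convolution (sym_group n)
      (convolution (sym_group n) v (w0B_coeff n \<alpha>)) (w0B_coeff n \<alpha>) w - (int k)\<^sup>2 * v w)"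
proof (cases "k = refine_count n \<alpha> (weak_order n f)")
  case True
  have "annihilated_above n \<alpha> k (convolution (sym_group n) v (w0B_coeff n \<alpha>))"
    using annihilated_above_convolution_w0B[OF \<alpha> v] .
  then show ?thesis
    using face_sum_convolution_w0B_lowest[OF \<alpha>] v True
    by (simp add: face_annihilates_def chamber_sum_diff power2_eq_square)
next
  case False
  then have "k < refine_count n \<alpha> (weak_order n f)" using k by simp
  moreover have "annihilated_above n \<alpha> k (convolution (sym_group n)
      (convolution (sym_group n) v (w0B_coeff n \<alpha>)) (w0B_coeff n \<alpha>))"
    using annihilated_above_convolution_w0B[OF \<alpha>] v by blast
  ultimately show ?thesis
    using v by (simp add: annihilated_above_def face_annihilates_def chamber_sum_diff)
qed

section \<open>Products of the quadratic factors\<close>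

text \<open>The product of the X^2 - k^2 in the convolution algebra, with the head of the list as
  leftmost factor.\<close>

definition quadratic_prod ::
  "('g, 'l) monoid_scheme \<Rightarrow> ('g \<Rightarrow> int) \<Rightarrow> nat list \<Rightarrow> 'g \<Rightarrow> int"
  where "quadratic_prod G X ks =
    foldr (\<lambda>k v x. convolution G X (convolution G X v) x - (int k)\<^sup>2 * v x) ks
      (\<lambda>x. of_bool (x = \<one>\<^bsub>G\<^esub>))"

text \<open>A polynomial in \<open>X\<close> commutes with \<open>X\<close>. This links the left
  multiplications in \<open>quadratic_prod\<close> to the right multiplications in the face
  formulas.\<close>

lemma quadratic_prod_commute:
  assumes "group G" "finite (carrier G)" "x \<in> carrier G"
  shows "convolution G X (quadratic_prod G X ks) x = convolution G (quadratic_prod G X ks) X x"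
  using assms(3)
proof (induction ks arbitrary: x)
  case Nil
  then show ?case
    using assms by (simp add: quadratic_prod_def convolution_one_left convolution_one_right)
next
  case (Cons k ks)
  define v where "v = quadratic_prod G X ks"
  have "convolution G X (convolution G X (convolution G X v)) x =
      convolution G X (convolution G X (convolution G v X)) x"
  proof (rule convolution_cong[OF assms(1) Cons.prems refl])
    fix y assume "y \<in> carrier G"
    then show "convolution G X (convolution G X v) y = convolution G X (convolution G v X) y"
      using Cons.IH by (intro convolution_cong[OF assms(1) _ refl]) (auto simp: v_def)
  qed
  also have "\<dots> = convolution G X (convolution G (convolution G X v) X) x"
    using assms Cons.prems by (intro convolution_cong[OF _ _ refl]) (auto simp: convolution_assoc)
  also have "\<dots> = convolution G (convolution G X (convolution G X v)) X x"
    using assms Cons.prems by (simp add: convolution_assoc)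
  finally show ?case
    using Cons.IH[OF Cons.prems]
    by (simp add: quadratic_prod_def v_def convolution_diff_left convolution_diff_right)
qed

text \<open>Works down from the largest value: the tail of the increasing list deals with counts
  above the head \<open>k\<close>, and the head factor then settles count \<open>k\<close>.\<close>

lemma annihilated_above_quadratic_prod:
  assumes \<alpha>: "is_composition n \<alpha>"
    and "sorted_wrt (<) ks" "set ks = {k \<in> n_comp n \<alpha> ` set_compositions n. j < k}"
  shows "annihilated_above n \<alpha> j (quadratic_prod (sym_group n) (w0B_coeff n \<alpha>) ks)"
  using assms(2,3)
proof (induction ks arbitrary: j)
  case Nil
  then show ?case
    \<comment> \<open>No count exceeds \<open>j\<close>, so the claim is vacuous.\<close>
    using refine_count_weak_order by (fastforce simp: annihilated_above_def)
next
  case (Cons k ks)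
  define X where "X = w0B_coeff n \<alpha>"
  define v where "v = quadratic_prod (sym_group n) X ks"
  \<comment> \<open>The induction hypothesis is applied with \<open>k\<close> in place of
    \<open>j\<close>.\<close>
  have "set ks = {i \<in> n_comp n \<alpha> ` set_compositions n. k < i}"
  proof -
    have "set ks = {i \<in> set (k # ks). k < i}" using Cons.prems(1) by auto
    moreover have "j < k" using Cons.prems(2) by auto
    ultimately show ?thesis unfolding Cons.prems(2) by auto
  qed
  then have v: "annihilated_above n \<alpha> k v"
    using Cons by (simp add: v_def X_def)
  have comm: "convolution (sym_group n) X v x = convolution (sym_group n) v X x"
    if "x \<in> carrier (sym_group n)" for x
    unfolding v_def using that
    by (intro quadratic_prod_commute sym_group_is_group finite_carrier_sym_group)
  \<comment> \<open>Both factors \<open>X\<close> are moved to the right of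
    \<open>v\<close>.\<close>
  have eq: "quadratic_prod (sym_group n) X (k # ks) x =
      convolution (sym_group n) (convolution (sym_group n) v X) X x - (int k)\<^sup>2 * v x"
    if x: "x \<in> carrier (sym_group n)" for x
  proof -
    have "convolution (sym_group n) X (convolution (sym_group n) X v) x =
        convolution (sym_group n) X (convolution (sym_group n) v X) x"
      by (rule convolution_cong[OF sym_group_is_group x]) (simp_all add: comm)
    also have "\<dots> = convolution (sym_group n) (convolution (sym_group n) X v) X x"
      using x by (simp add: convolution_assoc sym_group_is_group)
    also have "\<dots> = convolution (sym_group n) (convolution (sym_group n) v X) X x"
      by (rule convolution_cong[OF sym_group_is_group x]) (simp_all add: comm)
    finally show ?thesis by (simp add: quadratic_prod_def v_def)
  qed
  show ?case
    unfolding annihilated_above_def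
  proof (intro allI impI)
    fix f assume "j < refine_count n \<alpha> (weak_order n f)"
    then have "refine_count n \<alpha> (weak_order n f) \<in> set (k # ks)"
      using refine_count_weak_order[of n \<alpha> f] Cons.prems(2) by auto
    then have "k \<le> refine_count n \<alpha> (weak_order n f)"
      using Cons.prems(1) by auto
    then have "face_annihilates n (weak_order n f)
        (\<lambda>w. convolution (sym_group n) (convolution (sym_group n) v X) X w - (int k)\<^sup>2 * v w)"
      unfolding X_def using face_annihilates_quadratic[OF \<alpha> v] by blast
    then show "face_annihilates n (weak_order n f)
        (quadratic_prod (sym_group n) (w0B_coeff n \<alpha>) (k # ks))"
      using face_annihilates_cong[OF eq] by (simp add: X_def)
  qed
qed

text \<open>The empty relation is the unit of \<open>tits_prod\<close>, so once it kills a
  combination of chambers, every coefficient is 0.\<close>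

lemma w0B_quadratic_prod_eq_0:
  assumes \<alpha>: "is_composition n \<alpha>"
    and "sorted_wrt (<) ks" "set ks = n_comp n \<alpha> ` set_compositions n - {0}"
    and u: "u \<in> carrier (sym_group n)"
  shows "convolution (sym_group n) (w0B_coeff n \<alpha>)
    (quadratic_prod (sym_group n) (w0B_coeff n \<alpha>) ks) u = 0"
proof -
  define X where "X = w0B_coeff n \<alpha>"
  define v where "v = quadratic_prod (sym_group n) X ks"
  have "K - {0} = {k \<in> K. 0 < k}" for K :: "nat set" by auto
  then have v: "annihilated_above n \<alpha> 0 v"
    unfolding v_def X_def using assms(3)
    by (intro annihilated_above_quadratic_prod[OF assms(1,2)]) simp
  have empty: "weak_order n (\<lambda>_. 0) = {}" by (simp add: weak_order_def)
  have "face_annihilates n (weak_order n (\<lambda>_. 0)) (convolution (sym_group n) v X)"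
  \<comment> \<open>At count 0 the remaining factor \<open>X\<close> multiplies the sums by 0; at
    positive count the quadratic factors have already made them vanish.\<close>
  proof (cases "refine_count n \<alpha> (weak_order n (\<lambda>_. 0)) = 0")
    case True
    then show ?thesis
      using face_sum_convolution_w0B_lowest[OF \<alpha>, of "\<lambda>_. 0" v] v
      by (simp add: face_annihilates_def X_def)
  next
    case False
    then show ?thesis
      using annihilated_above_convolution_w0B[OF \<alpha> v] by (simp add: annihilated_above_def X_def)
  qed
  then have "chamber_sum n (\<lambda>C. C = chamber n u) (convolution (sym_group n) v X) = 0"
    by (simp add: face_annihilates_def empty tits_prod_def)
  then have "convolution (sym_group n) v X u = 0"
    using u by (simp add: chamber_sum_eq_chamber)
  then show ?thesis
    using quadratic_prod_commute[OF sym_group_is_group finite_carrier_sym_group u]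
    by (simp add: v_def X_def)
qed

section \<open>Return to the group algebra over \<open>R\<close>\<close>

lemma longest_perm_permutes: "longest_perm n permutes {1..n}"
proof (rule bij_imp_permutes)
  show "bij_betw (longest_perm n) {1..n} {1..n}"
    by (rule bij_betw_byWitness[where f' = "longest_perm n"]) (auto simp: longest_perm_def)
qed (auto simp: longest_perm_def)

lemma inv_longest_perm: "inv' (longest_perm n) = longest_perm n"
  by (rule inv_equality) (auto simp: longest_perm_def)

text \<open>Left multiplication by a basis element translates the argument by its inverse, and
  \<open>longest_perm n\<close> is its own inverse.\<close>

lemma w0B_eq_base_change:
  assumes "ring R"
  shows "group_algebra_basis R (sym_group n) (longest_perm n)
      \<otimes>\<^bsub>group_algebra R (sym_group n)\<^esub> B_elem R n \<alpha> =
    base_change R (sym_group n) (w0B_coeff n \<alpha>)"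
proof -
  let ?S = "sym_group n"
  let ?W = "{w \<in> carrier ?S. Des n w \<subseteq> comp_set \<alpha>}"
  have w0: "longest_perm n \<in> carrier ?S"
    using longest_perm_permutes by (simp add: sym_group_carrier)
  have fin: "finite ?W" using finite_carrier_sym_group by simp
  have "group_algebra_basis R ?S (longest_perm n) \<otimes>\<^bsub>group_algebra R ?S\<^esub> B_elem R n \<alpha> =
      base_change R ?S (\<lambda>x. of_bool (x = longest_perm n))
        \<otimes>\<^bsub>group_algebra R ?S\<^esub> base_change R ?S (\<lambda>x. of_bool (x \<in> ?W))"
    unfolding B_elem_def base_change_indicator[OF assms fin] base_change_basis[OF assms] ..
  also have "\<dots> = base_change R ?S (convolution ?S (\<lambda>x. of_bool (x = longest_perm n)) (\<lambda>x. of_bool (x \<in> ?W)))"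
    using assms by (intro base_change_mult sym_group_is_group finite_carrier_sym_group)
  also have "\<dots> = base_change R ?S (w0B_coeff n \<alpha>)"
  proof (rule base_change_cong)
    fix x assume x: "x \<in> carrier ?S"
    have "longest_perm n \<circ> x \<in> carrier ?S"
      using x w0 by (simp add: sym_group_carrier permutes_compose)
    then show "convolution ?S (\<lambda>x. of_bool (x = longest_perm n)) (\<lambda>x. of_bool (x \<in> ?W)) x = w0B_coeff n \<alpha> x"
      using w0 by (simp add: convolution_indicator_left sym_group_is_group finite_carrier_sym_group
          inv_longest_perm sym_group_mult w0B_coeff_def)
  qed
  finally show ?thesis .
qed

text \<open>As \<delta> is the convolution unit, the cross terms in (X + k)(X - k) cancel and each
  pair of linear factors becomes one quadratic step.\<close>

lemma ring_prod_list_quadratic: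
  fixes R :: "('r, 'm) ring_scheme" and G :: "('g, 'l) monoid_scheme" and X :: "'g \<Rightarrow> int"
  assumes R: "ring R" and G: "group G" "finite (carrier G)"
  defines "A \<equiv> group_algebra R G" and "x \<equiv> base_change R G X"
  shows "ring_prod_list A (map (\<lambda>k. (x \<oplus>\<^bsub>A\<^esub> [k] \<cdot>\<^bsub>A\<^esub> \<one>\<^bsub>A\<^esub>) \<otimes>\<^bsub>A\<^esub> (x \<ominus>\<^bsub>A\<^esub> [k] \<cdot>\<^bsub>A\<^esub> \<one>\<^bsub>A\<^esub>)) ks) =
    base_change R G (quadratic_prod G X ks)"
proof (induction ks)
  case Nil
  then show ?case
    by (simp add: ring_prod_list_def quadratic_prod_def A_def base_change_one[OF R])
next
  case (Cons k ks)
  define v where "v = quadratic_prod G X ks"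
  define \<delta> where "\<delta> = (\<lambda>x. of_bool (x = \<one>\<^bsub>G\<^esub>) :: int)"
  have "ring_prod_list A (map (\<lambda>k. (x \<oplus>\<^bsub>A\<^esub> [k] \<cdot>\<^bsub>A\<^esub> \<one>\<^bsub>A\<^esub>) \<otimes>\<^bsub>A\<^esub> (x \<ominus>\<^bsub>A\<^esub> [k] \<cdot>\<^bsub>A\<^esub> \<one>\<^bsub>A\<^esub>)) (k # ks)) =
      base_change R G (convolution G
        (convolution G (\<lambda>x. X x + int k * \<delta> x) (\<lambda>x. X x - int k * \<delta> x)) v)"
    using Cons.IH unfolding ring_prod_list_def x_def A_def v_def \<delta>_def
    by (simp add: base_change_nat_one[OF R] base_change_add[OF R] base_change_minus[OF R]
        base_change_mult[OF R G])
  also have "\<dots> = base_change R G (quadratic_prod G X (k # ks))"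
  proof (rule base_change_cong)
    fix y assume y: "y \<in> carrier G"
    have one: "convolution G \<delta> f z = f z" if "z \<in> carrier G" for f z
      unfolding \<delta>_def using convolution_one_left[OF G that] .
    have inner: "convolution G (\<lambda>x. X x - int k * \<delta> x) v z = convolution G X v z - int k * v z"
      if "z \<in> carrier G" for z
      using one[OF that] by (simp add: convolution_diff_left)
    have "convolution G (convolution G (\<lambda>x. X x + int k * \<delta> x) (\<lambda>x. X x - int k * \<delta> x)) v y =
        convolution G (\<lambda>x. X x + int k * \<delta> x) (convolution G (\<lambda>x. X x - int k * \<delta> x) v) y"
      using G y by (simp add: convolution_assoc)
    also have "\<dots> = convolution G (\<lambda>x. X x + int k * \<delta> x) (\<lambda>z. convolution G X v z - int k * v z) y"
      using G y inner by (intro convolution_cong[OF _ _ refl]) auto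
    also have "\<dots> = convolution G X (convolution G X v) y - (int k)\<^sup>2 * v y"
      using one[OF y]
      by (simp add: convolution_add_left convolution_diff_right power2_eq_square algebra_simps)
    finally show "convolution G (convolution G (\<lambda>x. X x + int k * \<delta> x) (\<lambda>x. X x - int k * \<delta> x)) v y =
        quadratic_prod G X (k # ks) y"
      by (simp add: quadratic_prod_def v_def)
  qed
  finally show ?case .
qed

text \<open>Ensures that \<open>sorted_list_of_set\<close> really lists the values, since it is
  empty on infinite sets. All counts are bounded by the number of set compositions of type
  \<alpha>.\<close>

lemma finite_n_comp_values: "finite (n_comp n \<alpha> ` set_compositions n)"
proof (rule finite_subset)
  show "n_comp n \<alpha> ` set_compositions n \<subseteq> {..card {G \<in> set_compositions n. sc_type G = \<alpha>}}"
    unfolding n_comp_def using finite_set_compositions_of_type[of n \<alpha>]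
    by (auto intro!: card_mono)
qed simp

theorem theorem5p7:
  fixes R :: "('r, 'm) ring_scheme" and n :: nat and \<alpha> :: "nat list"
  assumes "cring R" and "is_composition n \<alpha>"
  shows "let A = group_algebra R (sym_group n);
             x = group_algebra_basis R (sym_group n) (longest_perm n) \<otimes>\<^bsub>A\<^esub> B_elem R n \<alpha>
         in x \<otimes>\<^bsub>A\<^esub> ring_prod_list A
              (map (\<lambda>k. (x \<oplus>\<^bsub>A\<^esub> [k] \<cdot>\<^bsub>A\<^esub> \<one>\<^bsub>A\<^esub>) \<otimes>\<^bsub>A\<^esub> (x \<ominus>\<^bsub>A\<^esub> [k] \<cdot>\<^bsub>A\<^esub> \<one>\<^bsub>A\<^esub>))
                (sorted_list_of_set (n_comp n \<alpha> ` set_compositions n - {0})))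
            = \<zero>\<^bsub>A\<^esub>"
proof -
  let ?S = "sym_group n"
  define ks where "ks = sorted_list_of_set (n_comp n \<alpha> ` set_compositions n - {0})"
  have R: "ring R" using assms(1) by (rule cring.axioms(1))
  have S: "group ?S" "finite (carrier ?S)"
    by (rule sym_group_is_group, rule finite_carrier_sym_group)
  have ks: "sorted_wrt (<) ks" "set ks = n_comp n \<alpha> ` set_compositions n - {0}"
    using finite_n_comp_values by (simp_all add: ks_def)
  \<comment> \<open>The integral identity holds at every permutation, so its image over
    \<open>R\<close> is zero.\<close>
  have "base_change R ?S (convolution ?S (w0B_coeff n \<alpha>) (quadratic_prod ?S (w0B_coeff n \<alpha>) ks)) =
      \<zero>\<^bsub>group_algebra R ?S\<^esub>"
    unfolding base_change_zero[symmetric]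
    using w0B_quadratic_prod_eq_0[OF assms(2) ks] by (rule base_change_cong)
  then show ?thesis
    unfolding Let_def w0B_eq_base_change[OF R] ks_def[symmetric] ring_prod_list_quadratic[OF R S]
      base_change_mult[OF R S] .
qed

end
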